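(* Let $q\in\mathbb{C}$ with $0<|q|<1$ and let $U_q=U_q(\mathfrak{su}(1,1))$, with generators $J_0,J_\pm$, coproduct $\Delta$ and Casimir element $C$ as given in the context. In $U_q\otimes U_q$ put $$K_1=\frac14\,\frac{1-q^{J_0}\otimes q^{-J_0}}{1-q},\qquad K_2=\frac12\,\Delta(C),\qquad K_3=[K_1,K_2],$$ and $C^{(1)}=C\otimes1$, $C^{(2)}=1\otimes C$, $J_0^{(12)}=\Delta(J_0)$. Then \begin{align*} K_2 &= \frac{1}{2} \bigg( C \otimes q^{2J_0} + q^{-2J_0} \otimes C + J_+ q^{-2J_0-1} \otimes J_- + J_- q^{-2J_0+1} \otimes J_+ \\ &\qquad + \frac{q^2+1}{(q^2-1)^2} \Big( q^{-2J_0} \otimes q^{2J_0} - 1 \otimes q^{2J_0} - q^{-2J_0} \otimes 1 + 1 \otimes 1 \Big) \bigg),\\ K_3 &= \frac18(1+q^{-1})\big(J_+\otimes J_- - J_-\otimes J_+\big)\big(q^{-J_0}\otimes q^{-J_0}\big), \end{align*} the elements $C^{(1)}$, $C^{(2)}$, $J_0^{(12)}$ commute with $K_1,K_2,K_3$, and $K_1,K_2,K_3$ satisfy the (centrally extended) Askey--Wilson relations \begin{align*} [K_1,K_2]&=K_3,\\ [K_2,K_3]&=rK_2K_1K_2+\xi_1\{K_1,K_2\}+\xi_2K_2^2+\xi_3K_2+\xi_4K_1+\xi_5,\\ [K_3,K_1]&=rK_1K_2K_1+\xi_1K_1^2+\xi_2\{K_1,K_2\}+\xi_3K_1+\xi_6K_2+\xi_7,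 \end{align*} with \begin{align*} & r=-(q-q^{-1})^2,\qquad \xi_1=\frac{1+q^{-2}}{2},\qquad \xi_2=\frac{(1+q)^2(1-q)}{4q^2},\qquad \xi_3=4(q-1)\,\xi_7,\qquad \xi_4=0,\\ & \xi_5=-\frac{(1+q)(1+q^2)}{16q^3}\,(C^{(1)}-C^{(2)})\,[J_0^{(12)}]_q,\qquad \xi_6=-\frac{(1+q)^2}{16q^2},\\ & \xi_7=\frac{(1+q)^2}{32q^2}\Big(C^{(1)}q^{J_0^{(12)}}+C^{(2)}q^{-J_0^{(12)}}-(1+q^{-2})\big[\tfrac12J_0^{(12)}\big]_q^2\Big). \end{align*}
   Context: Notation: $[a,b]=ab-ba$, $\{a,b\}=ab+ba$, and $[x]_q=\dfrac{q^x-q^{-x}}{q-q^{-1}}$ (also for operators $x$). $U_q(\mathfrak{su}(1,1))$ is the unital associative algebra generated by $J_0,J_+,J_-$ with relations $$[J_0,J_\pm]=\pm J_\pm,\qquad J_-J_+-q^2J_+J_-=q^{2J_0}[2J_0]_q,$$ where exponentials $q^{\lambda J_0}$ are included and satisfy $q^{\lambda J_0}J_\pm=q^{\pm\lambda}J_\pm q^{\lambda J_0}$ (a logarithm of $q$ being fixed). The coproduct is the algebra morphism $\Delta:U_q(\mathfrak{su}(1,1))\to U_q(\mathfrak{su}(1,1))\otimes U_q(\mathfrak{su}(1,1))$ given by $$\Delta(J_0)=J_0\otimes1+1\otimes J_0,\qquad \Delta(J_\pm)=J_\pm\otimes q^{2J_0}+1\otimes J_\pm,$$ so that $q^{\lambda\Delta(J_0)}=q^{\lambda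 J_0}\otimes q^{\lambda J_0}$. The Casimir element, which is central, is $$C=J_+J_-q^{-2J_0+1}-\frac{q}{(q^2-1)^2}\big(q^{2J_0-1}+q^{-2J_0+1}\big)+\frac{q^2+1}{(q^2-1)^2}.$$ *)

theory Defs
  imports Complex_Main "HOL-Library.Poly_Mapping" "HOL-Algebra.QuotRing" "HOL-Algebra.Module"
begin

section \<open>Unital associative complex algebras\<close>

text \<open>The locale \<open>algebra\<close> of HOL-Algebra demands a commutative multiplication, so we only borrow its
  record type \<^typ>\<open>(complex, 'a) module\<close>.\<close>

locale complex_algebra = ring A for A :: "(complex, 'a) module" (structure) +
  assumes smult_closed [simp, intro]: "x \<in> carrier A \<Longrightarrow> c \<odot> x \<in> carrier A"
    and smult_l_distr: "x \<in> carrier A \<Longrightarrow> (c + d) \<odot> x = c \<odot> x \<oplus> d \<odot> x"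
    and smult_r_distr: "x \<in> carrier A \<Longrightarrow> y \<in> carrier A \<Longrightarrow> c \<odot> (x \<oplus> y) = c \<odot> x \<oplus> c \<odot> y"
    and smult_assoc: "x \<in> carrier A \<Longrightarrow> (c * d) \<odot> x = c \<odot> (d \<odot> x)"
    and smult_one [simp]: "x \<in> carrier A \<Longrightarrow> 1 \<odot> x = x"
    and smult_mult_l: "x \<in> carrier A \<Longrightarrow> y \<in> carrier A \<Longrightarrow> (c \<odot> x) \<otimes> y = c \<odot> (x \<otimes> y)"
    and smult_mult_r: "x \<in> carrier A \<Longrightarrow> y \<in> carrier A \<Longrightarrow> x \<otimes> (c \<odot> y) = c \<odot> (x \<otimes> y)"

definition algebra_hom :: "(complex, 'a) module \<Rightarrow> (complex, 'b) module \<Rightarrow> ('a \<Rightarrow> 'b) set" where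
  "algebra_hom A B = {f \<in> ring_hom A B. \<forall>c. \<forall>x\<in>carrier A. f (c \<odot>\<^bsub>A\<^esub> x) = c \<odot>\<^bsub>B\<^esub> f x}"

definition monoid_algebra :: "('m, 'x) monoid_scheme \<Rightarrow> (complex, 'm \<Rightarrow>\<^sub>0 complex) module" where
  "monoid_algebra M =
    \<lparr>carrier = {p. Poly_Mapping.keys p \<subseteq> carrier M},
     monoid.mult = (\<lambda>p r. \<Sum>x\<in>Poly_Mapping.keys p. \<Sum>y\<in>Poly_Mapping.keys r.
       Poly_Mapping.single (x \<otimes>\<^bsub>M\<^esub> y) (Poly_Mapping.lookup p x * Poly_Mapping.lookup r y)),
     one = Poly_Mapping.single \<one>\<^bsub>M\<^esub> 1,
     zero = 0,
     add = (+),
     smult = (\<lambda>c. Poly_Mapping.map ((*) c))\<rparr>"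

definition free_algebra :: "(complex, 'g list \<Rightarrow>\<^sub>0 complex) module" where
  "free_algebra = monoid_algebra \<lparr>carrier = UNIV, monoid.mult = (@), one = []\<rparr>"

abbreviation free_gen :: "'g \<Rightarrow> 'g list \<Rightarrow>\<^sub>0 complex" where
  "free_gen g \<equiv> Poly_Mapping.single [g] 1"

text \<open>The homomorphism on the free algebra that extends a map of generators.\<close>

definition free_eval :: "(complex, 'a) module \<Rightarrow> ('g \<Rightarrow> 'a) \<Rightarrow> ('g list \<Rightarrow>\<^sub>0 complex) \<Rightarrow> 'a" where
  "free_eval A f p = (\<Oplus>\<^bsub>A\<^esub>w\<in>Poly_Mapping.keys p.
     Poly_Mapping.lookup p w \<odot>\<^bsub>A\<^esub> foldr (\<lambda>g a. f g \<otimes>\<^bsub>A\<^esub> a) w \<one>\<^bsub>A\<^esub>)"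

text \<open>The quotient by the two-sided ideal generated by \<open>S\<close>, with the induced scalar multiplication.\<close>

definition quot_class :: "(complex, 'a) module \<Rightarrow> 'a set \<Rightarrow> 'a \<Rightarrow> 'a set" where
  "quot_class A S x = genideal A S +>\<^bsub>A\<^esub> x"

definition quot_algebra :: "(complex, 'a) module \<Rightarrow> 'a set \<Rightarrow> (complex, 'a set) module" where
  "quot_algebra A S = ring.extend (A Quot genideal A S)
     (module.fields (\<lambda>c X. \<Union>x\<in>X. quot_class A S (c \<odot>\<^bsub>A\<^esub> x)))"

section \<open>Tensor product of algebras\<close>

text \<open>The free vector space on \<open>carrier A \<times> carrier B\<close> with the product
  \<open>(a, b) (a', b') = (a a', b b')\<close> is the monoid algebra of \<open>A \<times>\<times> B\<close>.  The subspace spanned by the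
  bilinearity relations is stable under multiplication by basis elements, so it coincides with the
  ideal they generate.\<close>

definition tensor_rels ::
  "(complex, 'a) module \<Rightarrow> (complex, 'b) module \<Rightarrow> ('a \<times> 'b \<Rightarrow>\<^sub>0 complex) set" where
  "tensor_rels A B = (let \<iota> = (\<lambda>a b. Poly_Mapping.single (a, b) (1::complex)) in
     {\<iota> (a \<oplus>\<^bsub>A\<^esub> a') b - (\<iota> a b + \<iota> a' b) |a a' b. a \<in> carrier A \<and> a' \<in> carrier A \<and> b \<in> carrier B} \<union>
     {\<iota> a (b \<oplus>\<^bsub>B\<^esub> b') - (\<iota> a b + \<iota> a b') |a b b'. a \<in> carrier A \<and> b \<in> carrier B \<and> b' \<in> carrier B} \<union>
     {\<iota> (c \<odot>\<^bsub>A\<^esub> a) b - Poly_Mapping.single (a, b) c |c a b. a \<in> carrier A \<and> b \<in> carrier B} \<union>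
     {\<iota> a (c \<odot>\<^bsub>B\<^esub> b) - Poly_Mapping.single (a, b) c |c a b. a \<in> carrier A \<and> b \<in> carrier B})"

definition tensor_algebra ::
  "(complex, 'a) module \<Rightarrow> (complex, 'b) module \<Rightarrow> (complex, ('a \<times> 'b \<Rightarrow>\<^sub>0 complex) set) module" where
  "tensor_algebra A B = quot_algebra (monoid_algebra (A \<times>\<times> B)) (tensor_rels A B)"

definition pure_tensor ::
  "(complex, 'a) module \<Rightarrow> (complex, 'b) module \<Rightarrow> 'a \<Rightarrow> 'b \<Rightarrow> ('a \<times> 'b \<Rightarrow>\<^sub>0 complex) set" where
  "pure_tensor A B a b =
     quot_class (monoid_algebra (A \<times>\<times> B)) (tensor_rels A B) (Poly_Mapping.single (a, b) 1)"

section \<open>The algebra \<open>U_q(su(1,1))\<close>\<close>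

definition commutator :: "('a, 'x) ring_scheme \<Rightarrow> 'a \<Rightarrow> 'a \<Rightarrow> 'a" where
  "commutator A x y = x \<otimes>\<^bsub>A\<^esub> y \<ominus>\<^bsub>A\<^esub> y \<otimes>\<^bsub>A\<^esub> x"

definition anticommutator :: "('a, 'x) ring_scheme \<Rightarrow> 'a \<Rightarrow> 'a \<Rightarrow> 'a" where
  "anticommutator A x y = x \<otimes>\<^bsub>A\<^esub> y \<oplus>\<^bsub>A\<^esub> y \<otimes>\<^bsub>A\<^esub> x"

text \<open>\<open>q_bracket A q E x\<close> is the operator \<open>[x X]_q\<close>, where \<open>E y\<close> is the exponential \<open>q^(y X)\<close>.\<close>

definition q_bracket :: "(complex, 'a) module \<Rightarrow> complex \<Rightarrow> (complex \<Rightarrow> 'a) \<Rightarrow> complex \<Rightarrow> 'a" where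
  "q_bracket A q E x = (1 / (q - inverse q)) \<odot>\<^bsub>A\<^esub> (E x \<ominus>\<^bsub>A\<^esub> E (- x))"

datatype uq_gen = Gen_zero | Gen_plus | Gen_minus | Gen_exp complex

text \<open>The parameter \<open>h\<close> is the fixed logarithm of \<open>q\<close>: thus \<open>q = exp h\<close> and \<open>q^l = exp (h * l)\<close>.
  The generator \<^term>\<open>Gen_exp l\<close> stands for \<open>q^(l J0)\<close>.\<close>

definition uq_rels :: "complex \<Rightarrow> (uq_gen list \<Rightarrow>\<^sub>0 complex) set" where
  "uq_rels h = (
    let F = free_algebra; q = exp h; J0 = free_gen Gen_zero; Jp = free_gen Gen_plus;
        Jm = free_gen Gen_minus; E = (\<lambda>l. free_gen (Gen_exp l))
    in {commutator F J0 Jp \<ominus>\<^bsub>F\<^esub> Jp,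
        commutator F J0 Jm \<oplus>\<^bsub>F\<^esub> Jm,
        (Jm \<otimes>\<^bsub>F\<^esub> Jp \<ominus>\<^bsub>F\<^esub> q\<^sup>2 \<odot>\<^bsub>F\<^esub> (Jp \<otimes>\<^bsub>F\<^esub> Jm)) \<ominus>\<^bsub>F\<^esub> E 2 \<otimes>\<^bsub>F\<^esub> q_bracket F q E 2,
        E 0 \<ominus>\<^bsub>F\<^esub> \<one>\<^bsub>F\<^esub>} \<union>
       (\<Union>l. {commutator F J0 (E l),
             E l \<otimes>\<^bsub>F\<^esub> Jp \<ominus>\<^bsub>F\<^esub> exp (h * l) \<odot>\<^bsub>F\<^esub> (Jp \<otimes>\<^bsub>F\<^esub> E l),
             E l \<otimes>\<^bsub>F\<^esub> Jm \<ominus>\<^bsub>F\<^esub> exp (h * - l) \<odot>\<^bsub>F\<^esub> (Jm \<otimes>\<^bsub>F\<^esub> E l)}) \<union>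
       (\<Union>l. \<Union>m. {E (l + m) \<ominus>\<^bsub>F\<^esub> E l \<otimes>\<^bsub>F\<^esub> E m}))"

type_synonym uq_elem = "(uq_gen list \<Rightarrow>\<^sub>0 complex) set"
type_synonym uq2_elem = "(uq_elem \<times> uq_elem \<Rightarrow>\<^sub>0 complex) set"

definition Uq :: "complex \<Rightarrow> (complex, uq_elem) module" where
  "Uq h = quot_algebra free_algebra (uq_rels h)"

definition uq_gen :: "complex \<Rightarrow> uq_gen \<Rightarrow> uq_elem" where
  "uq_gen h g = quot_class free_algebra (uq_rels h) (free_gen g)"

definition J0 :: "complex \<Rightarrow> uq_elem" where "J0 h = uq_gen h Gen_zero"
definition Jp :: "complex \<Rightarrow> uq_elem" where "Jp h = uq_gen h Gen_plus"
definition Jm :: "complex \<Rightarrow> uq_elem" where "Jm h = uq_gen h Gen_minus"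

text \<open>\<open>qJ h l c\<close> is \<open>q^(l J0 + c)\<close>.\<close>

definition qJ :: "complex \<Rightarrow> complex \<Rightarrow> complex \<Rightarrow> uq_elem" where
  "qJ h l c = exp (h * c) \<odot>\<^bsub>Uq h\<^esub> uq_gen h (Gen_exp l)"

definition casimir :: "complex \<Rightarrow> uq_elem" where
  "casimir h = (let U = Uq h; q = exp h in
     (Jp h \<otimes>\<^bsub>U\<^esub> Jm h \<otimes>\<^bsub>U\<^esub> qJ h (-2) 1
       \<ominus>\<^bsub>U\<^esub> (q / (q\<^sup>2 - 1)\<^sup>2) \<odot>\<^bsub>U\<^esub> (qJ h 2 (-1) \<oplus>\<^bsub>U\<^esub> qJ h (-2) 1))
       \<oplus>\<^bsub>U\<^esub> ((q\<^sup>2 + 1) / (q\<^sup>2 - 1)\<^sup>2) \<odot>\<^bsub>U\<^esub> \<one>\<^bsub>U\<^esub>)"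

definition Uq2 :: "complex \<Rightarrow> (complex, uq2_elem) module" where
  "Uq2 h = tensor_algebra (Uq h) (Uq h)"

definition tens :: "complex \<Rightarrow> uq_elem \<Rightarrow> uq_elem \<Rightarrow> uq2_elem" where
  "tens h = pure_tensor (Uq h) (Uq h)"

section \<open>The coproduct\<close>

fun coproduct_gen :: "complex \<Rightarrow> uq_gen \<Rightarrow> uq2_elem" where
  "coproduct_gen h Gen_zero = tens h (J0 h) \<one>\<^bsub>Uq h\<^esub> \<oplus>\<^bsub>Uq2 h\<^esub> tens h \<one>\<^bsub>Uq h\<^esub> (J0 h)"
| "coproduct_gen h Gen_plus = tens h (Jp h) (qJ h 2 0) \<oplus>\<^bsub>Uq2 h\<^esub> tens h \<one>\<^bsub>Uq h\<^esub> (Jp h)"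
| "coproduct_gen h Gen_minus = tens h (Jm h) (qJ h 2 0) \<oplus>\<^bsub>Uq2 h\<^esub> tens h \<one>\<^bsub>Uq h\<^esub> (Jm h)"
| "coproduct_gen h (Gen_exp l) = tens h (qJ h l 0) (qJ h l 0)"

text \<open>An element of \<^term>\<open>Uq h\<close> is a coset of the ideal of relations, on which
  \<^const>\<open>free_eval\<close> is constant; see \<open>coproduct_hom\<close> and \<open>coproduct_uq_gen\<close> below.\<close>

definition coproduct :: "complex \<Rightarrow> uq_elem \<Rightarrow> uq2_elem" where
  "coproduct h X = the_elem (free_eval (Uq2 h) (coproduct_gen h) ` X)"

section \<open>Basic facts\<close>

lemma complex_poly_mapping_induct [consumes 1, case_names zero add]:
  fixes p :: "'m \<Rightarrow>\<^sub>0 complex"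
  assumes "Poly_Mapping.keys p \<subseteq> S" and z: "P 0"
    and s: "\<And>x c p. x \<in> S \<Longrightarrow> Poly_Mapping.keys p \<subseteq> S \<Longrightarrow> P p \<Longrightarrow> P (Poly_Mapping.single x c + p)"
  shows "P p"
proof -
  have "P p" if "finite K" "Poly_Mapping.keys p = K" "K \<subseteq> S" for K and p :: "'m \<Rightarrow>\<^sub>0 complex"
    using that
  proof (induction K arbitrary: p rule: finite_induct)
    case empty
    then show ?case using z by simp
  next
    case (insert x K)
    define r where "r = p - Poly_Mapping.single x (Poly_Mapping.lookup p x)"
    have l: "Poly_Mapping.lookup r y = (if y = x then 0 else Poly_Mapping.lookup p y)" for y
      by (auto simp: r_def lookup_minus lookup_single when_def)
    have k: "Poly_Mapping.keys r = K"
      using insert.hyps insert.prems by (auto simp: in_keys_iff l split: if_splits)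
    have "P r" using insert k by simp
    then have "P (Poly_Mapping.single x (Poly_Mapping.lookup p x) + r)"
      using insert.prems k by (intro s) auto
    then show ?case by (simp add: r_def)
  qed
  from this[OF finite_keys refl assms(1)] show ?thesis .
qed

definition pm_mult where
  "pm_mult M p r = (\<Sum>x\<in>Poly_Mapping.keys p. \<Sum>y\<in>Poly_Mapping.keys r.
       Poly_Mapping.single (x \<otimes>\<^bsub>M\<^esub> y) (Poly_Mapping.lookup p x * (Poly_Mapping.lookup r y :: complex)))"

lemma pm_mult_eq:
  assumes "finite X" "finite Y" "Poly_Mapping.keys p \<subseteq> X" "Poly_Mapping.keys r \<subseteq> Y"
  shows "pm_mult M p r = (\<Sum>x\<in>X. \<Sum>y\<in>Y.
       Poly_Mapping.single (x \<otimes>\<^bsub>M\<^esub> y) (Poly_Mapping.lookup p x * Poly_Mapping.lookup r y))"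
proof -
  have "(\<Sum>y\<in>Poly_Mapping.keys r. Poly_Mapping.single (x \<otimes>\<^bsub>M\<^esub> y) (Poly_Mapping.lookup p x * Poly_Mapping.lookup r y))
    = (\<Sum>y\<in>Y. Poly_Mapping.single (x \<otimes>\<^bsub>M\<^esub> y) (Poly_Mapping.lookup p x * Poly_Mapping.lookup r y))" for x
    by (rule sum.mono_neutral_left) (use assms in \<open>auto simp: in_keys_iff\<close>)
  then show ?thesis unfolding pm_mult_def
    by simp (rule sum.mono_neutral_left, use assms in \<open>auto simp: in_keys_iff\<close>)
qed

lemma pm_mult_add_left: "pm_mult M (p + p') r = pm_mult M p r + pm_mult M p' r"
proof -
  let ?X = "Poly_Mapping.keys p \<union> Poly_Mapping.keys p'" and ?Y = "Poly_Mapping.keys r"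
  have "Poly_Mapping.keys (p + p') \<subseteq> ?X" by (rule keys_add)
  then show ?thesis
    by (simp add: pm_mult_eq[of ?X ?Y] lookup_add single_add distrib_right sum.distrib)
qed

lemma pm_mult_add_right: "pm_mult M r (p + p') = pm_mult M r p + pm_mult M r p'"
proof -
  let ?X = "Poly_Mapping.keys p \<union> Poly_Mapping.keys p'" and ?Y = "Poly_Mapping.keys r"
  have "Poly_Mapping.keys (p + p') \<subseteq> ?X" by (rule keys_add)
  then show ?thesis
    by (simp add: pm_mult_eq[of ?Y ?X] lookup_add single_add distrib_left sum.distrib)
qed

lemma pm_mult_zero [simp]: "pm_mult M 0 r = 0" "pm_mult M r 0 = 0"
  by (simp_all add: pm_mult_def)

lemma pm_mult_single [simp]:
  "pm_mult M (Poly_Mapping.single x c) (Poly_Mapping.single y d) = Poly_Mapping.single (x \<otimes>\<^bsub>M\<^esub> y) (c * d)"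
  by (subst pm_mult_eq[of "{x}" "{y}"]) auto

definition pm_scale :: "complex \<Rightarrow> ('m \<Rightarrow>\<^sub>0 complex) \<Rightarrow> 'm \<Rightarrow>\<^sub>0 complex" where
  "pm_scale c = Poly_Mapping.map ((*) c)"

lemma lookup_pm_scale [simp]: "Poly_Mapping.lookup (pm_scale c p) x = c * Poly_Mapping.lookup p x"
  by (simp add: pm_scale_def Poly_Mapping.map.rep_eq when_def)

lemma pm_scale_simps [simp]:
  "pm_scale c (p + r) = pm_scale c p + pm_scale c r" "pm_scale c 0 = 0"
  "pm_scale c (Poly_Mapping.single x d) = Poly_Mapping.single x (c * d)"
  by (auto intro!: poly_mapping_eqI simp: lookup_add lookup_single when_def distrib_left)

lemma keys_pm_scale: "Poly_Mapping.keys (pm_scale c p) \<subseteq> Poly_Mapping.keys p"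
  by (auto simp: in_keys_iff)

lemma monoid_algebra_sel [simp]:
  "carrier (monoid_algebra M) = {p. Poly_Mapping.keys p \<subseteq> carrier M}"
  "monoid.mult (monoid_algebra M) = pm_mult M"
  "monoid.one (monoid_algebra M) = Poly_Mapping.single \<one>\<^bsub>M\<^esub> 1"
  "ring.zero (monoid_algebra M) = 0" "ring.add (monoid_algebra M) = (+)"
  "module.smult (monoid_algebra M) = pm_scale"
  by (simp_all add: monoid_algebra_def pm_mult_def pm_scale_def fun_eq_iff)

lemma keys_single_subset: "x \<in> S \<Longrightarrow> Poly_Mapping.keys (Poly_Mapping.single x c) \<subseteq> S"
  by simp

context monoid begin

lemma pm_mult_closed:
  assumes "Poly_Mapping.keys p \<subseteq> carrier G" "Poly_Mapping.keys r \<subseteq> carrier G"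
  shows "Poly_Mapping.keys (pm_mult G p r) \<subseteq> carrier G"
  unfolding pm_mult_def
  by (rule order_trans[OF keys_sum] UN_least keys_single_subset)+ (use assms in auto)

lemma pm_mult_assoc:
  assumes "Poly_Mapping.keys p \<subseteq> carrier G" "Poly_Mapping.keys r \<subseteq> carrier G" "Poly_Mapping.keys s \<subseteq> carrier G"
  shows "pm_mult G (pm_mult G p r) s = pm_mult G p (pm_mult G r s)"
  using assms(1)
proof (induction rule: complex_poly_mapping_induct)
  case (add x c p)
  have "pm_mult G (pm_mult G (Poly_Mapping.single x c) r) s = pm_mult G (Poly_Mapping.single x c) (pm_mult G r s)"
    using assms(2)
  proof (induction rule: complex_poly_mapping_induct)
    case (add y d r)
    have "pm_mult G (pm_mult G (Poly_Mapping.single x c) (Poly_Mapping.single y d)) s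
        = pm_mult G (Poly_Mapping.single x c) (pm_mult G (Poly_Mapping.single y d) s)"
      using assms(3)
    proof (induction rule: complex_poly_mapping_induct)
      case (add z e s)
      then show ?case using \<open>x \<in> carrier G\<close> \<open>y \<in> carrier G\<close>
        by (simp add: pm_mult_add_right m_assoc mult.assoc)
    qed simp
    then show ?case by (simp add: pm_mult_add_left pm_mult_add_right add)
  qed simp
  then show ?case by (simp add: pm_mult_add_left add)
qed simp

lemma pm_mult_one:
  assumes "Poly_Mapping.keys p \<subseteq> carrier G"
  shows "pm_mult G (Poly_Mapping.single \<one> 1) p = p" "pm_mult G p (Poly_Mapping.single \<one> 1) = p"
  using assms by (induction rule: complex_poly_mapping_induct) (simp_all add: pm_mult_add_left pm_mult_add_right)

lemma pm_mult_scale: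
  "pm_mult G (pm_scale c p) r = pm_scale c (pm_mult G p r)"
  "pm_mult G p (pm_scale c r) = pm_scale c (pm_mult G p r)"
proof -
  have S: "pm_scale c (sum f A) = (\<Sum>a\<in>A. pm_scale c (f a))" for f :: "'z \<Rightarrow> 'a \<Rightarrow>\<^sub>0 complex" and A
    by (induction A rule: infinite_finite_induct) auto
  have k: "finite (Poly_Mapping.keys p)" "finite (Poly_Mapping.keys r)" by auto
  show "pm_mult G (pm_scale c p) r = pm_scale c (pm_mult G p r)"
    by (simp add: pm_mult_eq[OF k keys_pm_scale order_refl] pm_mult_eq[OF k order_refl order_refl] S mult.assoc)
  show "pm_mult G p (pm_scale c r) = pm_scale c (pm_mult G p r)"
    by (simp add: pm_mult_eq[OF k order_refl keys_pm_scale] pm_mult_eq[OF k order_refl order_refl] S mult.left_commute)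
qed

lemma monoid_algebra_ring: "ring (monoid_algebra G)"
proof (rule ringI)
  show "abelian_group (monoid_algebra G)"
  proof (rule abelian_groupI)
    fix x assume "x \<in> carrier (monoid_algebra G)"
    then show "\<exists>y\<in>carrier (monoid_algebra G). y \<oplus>\<^bsub>monoid_algebra G\<^esub> x = \<zero>\<^bsub>monoid_algebra G\<^esub>"
      by (intro bexI[of _ "- x"]) (auto simp: in_keys_iff)
  qed (auto simp: ac_simps dest: subsetD[OF keys_add])
  show "Group.monoid (monoid_algebra G)"
    by standard (auto simp: pm_mult_assoc pm_mult_one dest: subsetD[OF pm_mult_closed])
qed (auto simp: pm_mult_add_left pm_mult_add_right)

lemma complex_algebra_monoid_algebra: "complex_algebra (monoid_algebra G)"
proof -
  interpret A: ring "monoid_algebra G" by (rule monoid_algebra_ring)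
  show ?thesis
    by standard (auto simp: pm_mult_scale in_keys_iff lookup_add distrib_right distrib_left mult.assoc intro!: poly_mapping_eqI)
qed

end

subsection \<open>Quotients\<close>

lemma quot_algebra_sel:
  "carrier (quot_algebra A S) = carrier (A Quot genideal A S)"
  "monoid.mult (quot_algebra A S) = monoid.mult (A Quot genideal A S)"
  "monoid.one (quot_algebra A S) = monoid.one (A Quot genideal A S)"
  "ring.zero (quot_algebra A S) = ring.zero (A Quot genideal A S)"
  "ring.add (quot_algebra A S) = ring.add (A Quot genideal A S)"
  "module.smult (quot_algebra A S) = (\<lambda>c X. \<Union>x\<in>X. quot_class A S (c \<odot>\<^bsub>A\<^esub> x))"
  by (simp_all add: quot_algebra_def ring.defs module.defs FactRing_def)

lemma ring_cong:
  fixes R :: "('a, 'x) ring_scheme" and R' :: "('a, 'y) ring_scheme"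
  assumes "ring R" "carrier R' = carrier R" "monoid.mult R' = monoid.mult R"
    "monoid.one R' = monoid.one R" "ring.zero R' = ring.zero R" "ring.add R' = ring.add R"
  shows "ring R'"
proof -
  interpret ring R by fact
  show ?thesis
  proof (rule ringI)
    show "abelian_group R'"
      by (rule abelian_groupI) (auto simp: assms a_assoc a_comm a_lcomm intro: l_neg)
    show "Group.monoid R'"
      by (rule monoidI) (auto simp: assms m_assoc)
  qed (auto simp: assms l_distr r_distr)
qed

context complex_algebra begin

lemma smult_minus: "x \<in> carrier A \<Longrightarrow> c \<odot> (\<ominus> x) = \<ominus> (c \<odot> x)"
proof -
  assume x: "x \<in> carrier A"
  have "c \<odot> (\<ominus> x) = (c \<odot> \<one>) \<otimes> (\<ominus> x)" using x by (simp add: smult_mult_l)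
  also have "\<dots> = \<ominus> ((c \<odot> \<one>) \<otimes> x)" using x by (simp add: r_minus)
  finally show ?thesis using x by (simp add: smult_mult_l)
qed

context fixes S assumes S: "S \<subseteq> carrier A" begin

lemma quot_ideal: "ideal (Idl S) A" by (rule genideal_ideal[OF S])
interpretation I: ideal "Idl S" A by (rule quot_ideal)

lemma quot_ring: "ring (quot_algebra A S)"
  by (rule ring_cong[OF I.quotient_is_ring]) (simp_all add: quot_algebra_sel)

lemma quot_carrier: "carrier (quot_algebra A S) = quot_class A S ` carrier A"
  by (auto simp: quot_algebra_sel FactRing_def A_RCOSETS_def' quot_class_def)

lemma quot_class_closed [simp]: "x \<in> carrier A \<Longrightarrow> quot_class A S x \<in> carrier (quot_algebra A S)"
  by (simp add: quot_carrier)

lemma quot_class_eq_iff: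
  assumes "x \<in> carrier A" "y \<in> carrier A"
  shows "quot_class A S x = quot_class A S y \<longleftrightarrow> x \<ominus> y \<in> Idl S"
  unfolding quot_class_def by (rule quotient_eq_iff_same_a_r_cos[OF quot_ideal assms, symmetric])

lemma quot_class_add:
  "x \<in> carrier A \<Longrightarrow> y \<in> carrier A \<Longrightarrow>
    quot_class A S (x \<oplus> y) = quot_class A S x \<oplus>\<^bsub>quot_algebra A S\<^esub> quot_class A S y"
  using I.rcos_ring_hom by (simp add: ring_hom_def quot_class_def quot_algebra_sel)

lemma quot_class_mult:
  "x \<in> carrier A \<Longrightarrow> y \<in> carrier A \<Longrightarrow>
    quot_class A S (x \<otimes> y) = quot_class A S x \<otimes>\<^bsub>quot_algebra A S\<^esub> quot_class A S y"
  using I.rcos_ring_hom by (simp add: ring_hom_def quot_class_def quot_algebra_sel)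

lemma quot_class_one: "quot_class A S \<one> = \<one>\<^bsub>quot_algebra A S\<^esub>"
  using I.rcos_ring_hom by (simp add: ring_hom_def quot_class_def quot_algebra_sel)

lemma smult_in_Idl: "i \<in> Idl S \<Longrightarrow> c \<odot> i \<in> Idl S"
  using I.I_l_closed[of i "c \<odot> \<one>"] I.Icarr[of i] by (simp add: smult_mult_l)

lemma quot_class_smult:
  assumes "x \<in> carrier A"
  shows "quot_class A S (c \<odot> x) = c \<odot>\<^bsub>quot_algebra A S\<^esub> quot_class A S x"
proof -
  have "quot_class A S (c \<odot> y) = quot_class A S (c \<odot> x)" if "y \<in> quot_class A S x" for y
  proof -
    obtain i where i: "i \<in> Idl S" "y = i \<oplus> x"
      using \<open>y \<in> quot_class A S x\<close> by (auto simp: quot_class_def a_r_coset_def')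
    have "i \<in> carrier A" using i I.Icarr by simp
    then have "c \<odot> y \<ominus> c \<odot> x = c \<odot> i"
      using assms i(2) by (simp add: smult_r_distr a_minus_def a_assoc r_neg)
    with i \<open>i \<in> carrier A\<close> show ?thesis using assms smult_in_Idl by (subst quot_class_eq_iff) auto
  qed
  moreover have "x \<in> quot_class A S x"
    using assms by (simp add: quot_class_def I.a_rcos_self)
  ultimately show ?thesis unfolding quot_algebra_sel by blast
qed

lemma complex_algebra_quot: "complex_algebra (quot_algebra A S)"
proof -
  interpret Q: ring "quot_algebra A S" by (rule quot_ring)
  show ?thesis
  proof
    fix X c assume "X \<in> carrier (quot_algebra A S)"
    then obtain x where x: "x \<in> carrier A" "X = quot_class A S x" by (auto simp: quot_carrier)
    show "c \<odot>\<^bsub>quot_algebra A S\<^esub> X \<in> carrier (quot_algebra A S)"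
      using x by (simp flip: quot_class_smult)
    show "1 \<odot>\<^bsub>quot_algebra A S\<^esub> X = X" using x by (simp flip: quot_class_smult)
    fix d
    show "(c + d) \<odot>\<^bsub>quot_algebra A S\<^esub> X = c \<odot>\<^bsub>quot_algebra A S\<^esub> X \<oplus>\<^bsub>quot_algebra A S\<^esub> d \<odot>\<^bsub>quot_algebra A S\<^esub> X"
      using x by (simp add: smult_l_distr flip: quot_class_smult quot_class_add)
    show "(c * d) \<odot>\<^bsub>quot_algebra A S\<^esub> X = c \<odot>\<^bsub>quot_algebra A S\<^esub> (d \<odot>\<^bsub>quot_algebra A S\<^esub> X)"
      using x by (simp add: smult_assoc flip: quot_class_smult)
    fix Y assume "Y \<in> carrier (quot_algebra A S)"
    then obtain y where y: "y \<in> carrier A" "Y = quot_class A S y" by (auto simp: quot_carrier)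
    show "c \<odot>\<^bsub>quot_algebra A S\<^esub> (X \<oplus>\<^bsub>quot_algebra A S\<^esub> Y) = c \<odot>\<^bsub>quot_algebra A S\<^esub> X \<oplus>\<^bsub>quot_algebra A S\<^esub> c \<odot>\<^bsub>quot_algebra A S\<^esub> Y"
      using x y by (simp add: smult_r_distr flip: quot_class_smult quot_class_add)
    show "(c \<odot>\<^bsub>quot_algebra A S\<^esub> X) \<otimes>\<^bsub>quot_algebra A S\<^esub> Y = c \<odot>\<^bsub>quot_algebra A S\<^esub> (X \<otimes>\<^bsub>quot_algebra A S\<^esub> Y)"
      using x y by (simp add: smult_mult_l flip: quot_class_smult quot_class_mult)
    show "X \<otimes>\<^bsub>quot_algebra A S\<^esub> (c \<odot>\<^bsub>quot_algebra A S\<^esub> Y) = c \<odot>\<^bsub>quot_algebra A S\<^esub> (X \<otimes>\<^bsub>quot_algebra A S\<^esub> Y)"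
      using x y by (simp add: smult_mult_r flip: quot_class_smult quot_class_mult)
  qed
qed

lemma quot_class_hom: "quot_class A S \<in> algebra_hom A (quot_algebra A S)"
  by (auto simp: algebra_hom_def ring_hom_def quot_class_add quot_class_mult quot_class_one quot_class_smult)

end
end


lemma (in complex_algebra) smult_zero_left [simp]: "x \<in> carrier A \<Longrightarrow> 0 \<odot> x = \<zero>"
  using smult_l_distr[of x 0 0] by simp

lemma (in complex_algebra) smult_zero_right [simp]: "c \<odot> \<zero> = \<zero>"
  using smult_r_distr[of \<zero> \<zero> c] by simp

lemma (in complex_algebra) smult_left_commute: "x \<in> carrier A \<Longrightarrow> c \<odot> (d \<odot> x) = d \<odot> (c \<odot> x)"
  by (simp add: mult.commute flip: smult_assoc)

lemma algebra_homD:
  assumes "f \<in> algebra_hom A B"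
  shows "x \<in> carrier A \<Longrightarrow> f x \<in> carrier B"
    "x \<in> carrier A \<Longrightarrow> y \<in> carrier A \<Longrightarrow> f (x \<oplus>\<^bsub>A\<^esub> y) = f x \<oplus>\<^bsub>B\<^esub> f y"
    "x \<in> carrier A \<Longrightarrow> y \<in> carrier A \<Longrightarrow> f (x \<otimes>\<^bsub>A\<^esub> y) = f x \<otimes>\<^bsub>B\<^esub> f y"
    "f \<one>\<^bsub>A\<^esub> = \<one>\<^bsub>B\<^esub>" "x \<in> carrier A \<Longrightarrow> f (c \<odot>\<^bsub>A\<^esub> x) = c \<odot>\<^bsub>B\<^esub> f x"
  using assms by (auto simp: algebra_hom_def ring_hom_def)

lemma algebra_hom_minus:
  assumes "f \<in> algebra_hom A B" "complex_algebra A" "complex_algebra B"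
    and "x \<in> carrier A" "y \<in> carrier A"
  shows "f (x \<ominus>\<^bsub>A\<^esub> y) = f x \<ominus>\<^bsub>B\<^esub> f y"
proof -
  interpret A: complex_algebra A by fact
  interpret B: complex_algebra B by fact
  interpret ring_hom_ring A B f
    using assms(1) A.ring_axioms B.ring_axioms by (intro ring_hom_ringI2) (auto simp: algebra_hom_def)
  show ?thesis using assms(4,5) by (simp add: A.minus_eq B.minus_eq)
qed

lemma quot_lift_eq:
  assumes f: "f \<in> algebra_hom A B" and A: "complex_algebra A" and B: "complex_algebra B"
    and S: "S \<subseteq> carrier A" and z: "\<And>s. s \<in> S \<Longrightarrow> f s = \<zero>\<^bsub>B\<^esub>" and x: "x \<in> carrier A"
  shows "the_elem (f ` quot_class A S x) = f x"
proof -
  interpret A: complex_algebra A by fact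
  interpret B: complex_algebra B by fact
  interpret ring_hom_ring A B f
    using f A.ring_axioms B.ring_axioms by (intro ring_hom_ringI2) (auto simp: algebra_hom_def)
  interpret I: ideal "genideal A S" A by (rule A.quot_ideal[OF S])
  have K: "genideal A S \<subseteq> a_kernel A B f"
  proof (rule A.genideal_minimal[OF kernel_is_ideal])
    show "S \<subseteq> a_kernel A B f" using S z unfolding a_kernel_def' by blast
  qed
  have "f y = f x" if "y \<in> quot_class A S x" for y
  proof -
    obtain i where i: "i \<in> genideal A S" "y = i \<oplus>\<^bsub>A\<^esub> x"
      using \<open>y \<in> quot_class A S x\<close> unfolding quot_class_def a_r_coset_def' by blast
    then have "i \<in> carrier A" "f i = \<zero>\<^bsub>B\<^esub>" using K unfolding a_kernel_def' by blast+
    then show ?thesis using i(2) x by simp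
  qed
  moreover have "x \<in> quot_class A S x" using x by (simp add: quot_class_def I.a_rcos_self)
  ultimately have "f ` quot_class A S x = {f x}" by blast
  then show ?thesis by simp
qed

lemma quot_lift_hom:
  assumes f: "f \<in> algebra_hom A B" and A: "complex_algebra A" and B: "complex_algebra B"
    and S: "S \<subseteq> carrier A" and z: "\<And>s. s \<in> S \<Longrightarrow> f s = \<zero>\<^bsub>B\<^esub>"
  shows "(\<lambda>X. the_elem (f ` X)) \<in> algebra_hom (quot_algebra A S) B"
proof -
  interpret A: complex_algebra A by fact
  note e = quot_lift_eq[OF f A B S z]
  note h = algebra_homD[OF f]
  show ?thesis
    unfolding algebra_hom_def ring_hom_def
    by (auto simp: A.quot_carrier[OF S] e h
        simp flip: A.quot_class_add[OF S] A.quot_class_mult[OF S] A.quot_class_one[OF S] A.quot_class_smult[OF S])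
qed

subsection \<open>Free algebras\<close>

lemma monoid_free: "Group.monoid \<lparr>carrier = UNIV, monoid.mult = (@), one = []\<rparr>"
  by standard auto

lemma complex_algebra_free: "complex_algebra free_algebra"
  unfolding free_algebra_def by (rule monoid.complex_algebra_monoid_algebra[OF monoid_free])

lemma free_carrier [simp]: "carrier free_algebra = UNIV"
  by (simp add: free_algebra_def)

context complex_algebra begin

context fixes f :: "'g \<Rightarrow> 'a" assumes f: "\<And>g. f g \<in> carrier A" begin

definition word_eval :: "'g list \<Rightarrow> 'a" where "word_eval w = foldr (\<lambda>g a. f g \<otimes> a) w \<one>"

lemma word_eval_closed [simp]: "word_eval w \<in> carrier A"
  unfolding word_eval_def by (induction w) (auto simp: f)

lemma word_eval_simps: "word_eval [] = \<one>" "word_eval (g # w) = f g \<otimes> word_eval w"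
  by (simp_all add: word_eval_def)

lemma word_eval_append: "word_eval (v @ w) = word_eval v \<otimes> word_eval w"
  by (induction v) (auto simp: word_eval_simps f m_assoc)

lemma free_eval_eq:
  assumes "finite X" "Poly_Mapping.keys p \<subseteq> X"
  shows "free_eval A f p = (\<Oplus>w\<in>X. Poly_Mapping.lookup p w \<odot> word_eval w)"
  unfolding free_eval_def word_eval_def[symmetric]
  by (rule add.finprod_mono_neutral_cong_left) (use assms in \<open>auto simp: in_keys_iff\<close>)

lemma free_eval_closed [simp]: "free_eval A f p \<in> carrier A"
  unfolding free_eval_def word_eval_def[symmetric] by (rule finsum_closed) auto

lemma free_eval_add: "free_eval A f (p + r) = free_eval A f p \<oplus> free_eval A f r"
proof -
  let ?X = "Poly_Mapping.keys p \<union> Poly_Mapping.keys r"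
  have "Poly_Mapping.keys (p + r) \<subseteq> ?X" by (rule keys_add)
  then show ?thesis
    by (simp add: free_eval_eq[of ?X] lookup_add smult_l_distr finsum_addf Pi_def)
qed

lemma free_eval_single: "free_eval A f (Poly_Mapping.single w c) = c \<odot> word_eval w"
  by (subst free_eval_eq[of "{w}"]) auto

lemma free_eval_gen: "free_eval A f (free_gen g) = f g"
  by (simp add: free_eval_single word_eval_def f)

lemma free_eval_zero: "free_eval A f 0 = \<zero>"
  by (simp add: free_eval_def)

lemma free_eval_hom: "free_eval A f \<in> algebra_hom free_algebra A"
proof -
  let ?M = "\<lparr>carrier = UNIV, monoid.mult = (@), one = []\<rparr>"
  have s: "free_eval A f (pm_scale c p) = c \<odot> free_eval A f p" for c p
  proof -
    have "Poly_Mapping.keys p \<subseteq> UNIV" by simp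
    then show ?thesis
      by (induction rule: complex_poly_mapping_induct)
        (simp_all add: free_eval_zero free_eval_add free_eval_single smult_r_distr smult_assoc)
  qed
  have "free_eval A f (pm_mult ?M p r) = free_eval A f p \<otimes> free_eval A f r" for p r
  proof -
    have "Poly_Mapping.keys p \<subseteq> UNIV" by simp
    then show ?thesis
    proof (induction rule: complex_poly_mapping_induct)
      case (add x c p)
      have "Poly_Mapping.keys r \<subseteq> UNIV" by simp
      then have "free_eval A f (pm_mult ?M (Poly_Mapping.single x c) r) = free_eval A f (Poly_Mapping.single x c) \<otimes> free_eval A f r"
        by (induction rule: complex_poly_mapping_induct)
          (simp_all add: free_eval_zero free_eval_add free_eval_single pm_mult_add_right r_distr
            smult_mult_l smult_mult_r smult_assoc word_eval_append smult_left_commute)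
      then show ?case by (simp add: free_eval_add pm_mult_add_left add l_distr)
    qed (simp add: free_eval_zero)
  qed
  then show ?thesis
    by (auto simp: algebra_hom_def ring_hom_def free_algebra_def free_eval_add s free_eval_single)
      (simp add: word_eval_def)
qed

end
end

subsection \<open>Tensor products\<close>

locale two_algebras = A: complex_algebra A + B: complex_algebra B for A B
begin

abbreviation "T \<equiv> tensor_algebra A B"
abbreviation "P \<equiv> monoid_algebra (A \<times>\<times> B)"
abbreviation "t \<equiv> pure_tensor A B"

interpretation M: monoid "A \<times>\<times> B" by (rule DirProd_monoid[OF A.monoid_axioms B.monoid_axioms])
interpretation P: complex_algebra P by (rule M.complex_algebra_monoid_algebra)

lemma tensor_rels_closed: "tensor_rels A B \<subseteq> carrier P"
proof -
  have d: "p - r \<in> carrier P" if "p \<in> carrier P" "r \<in> carrier P" for p r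
    using that keys_diff[of p r] by auto
  have a: "p + r \<in> carrier P" if "p \<in> carrier P" "r \<in> carrier P" for p r
    using P.a_closed[OF that] by simp
  have s: "Poly_Mapping.single (a, b) c \<in> carrier P" if "a \<in> carrier A" "b \<in> carrier B" for a b c
    using that by simp
  show ?thesis
    unfolding tensor_rels_def Let_def by (auto intro!: d a s simp del: monoid_algebra_sel)
qed

lemmas cls = P.quot_class_eq_iff[OF tensor_rels_closed] P.quot_class_add[OF tensor_rels_closed]
  P.quot_class_mult[OF tensor_rels_closed] P.quot_class_one[OF tensor_rels_closed]
  P.quot_class_smult[OF tensor_rels_closed] P.quot_class_closed[OF tensor_rels_closed]

lemma complex_algebra_tensor: "complex_algebra T"
  unfolding tensor_algebra_def by (rule P.complex_algebra_quot[OF tensor_rels_closed])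

lemma P_minus: "x \<in> carrier P \<Longrightarrow> y \<in> carrier P \<Longrightarrow> x \<ominus>\<^bsub>P\<^esub> y = x - y"
proof -
  assume xy: "x \<in> carrier P" "y \<in> carrier P"
  have "\<ominus>\<^bsub>P\<^esub> y = - y" using xy by (intro P.minus_equality) (auto simp: in_keys_iff)
  then show ?thesis by (simp add: a_minus_def)
qed

lemma rel_class_eq:
  assumes "p - r \<in> tensor_rels A B" "p \<in> carrier P" "r \<in> carrier P"
  shows "quot_class P (tensor_rels A B) p = quot_class P (tensor_rels A B) r"
  using assms P.genideal_self[OF tensor_rels_closed] by (simp only: cls P_minus) auto

lemma pure_tensor_closed [simp]: "a \<in> carrier A \<Longrightarrow> b \<in> carrier B \<Longrightarrow> t a b \<in> carrier T"
  unfolding pure_tensor_def tensor_algebra_def by (rule cls) simp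

lemma single_closed: "a \<in> carrier A \<Longrightarrow> b \<in> carrier B \<Longrightarrow> Poly_Mapping.single (a, b) c \<in> carrier P"
  by simp

lemma pure_tensor_add_left:
  assumes "a \<in> carrier A" "a' \<in> carrier A" "b \<in> carrier B"
  shows "t (a \<oplus>\<^bsub>A\<^esub> a') b = t a b \<oplus>\<^bsub>T\<^esub> t a' b"
proof -
  let ?x = "Poly_Mapping.single (a, b) 1" and ?y = "Poly_Mapping.single (a', b) 1"
  have c: "?x \<oplus>\<^bsub>P\<^esub> ?y \<in> carrier P" using assms by (intro P.a_closed single_closed)
  have "t (a \<oplus>\<^bsub>A\<^esub> a') b = quot_class P (tensor_rels A B) (?x \<oplus>\<^bsub>P\<^esub> ?y)"
    unfolding pure_tensor_def
    by (rule rel_class_eq) (use assms c in \<open>auto simp: tensor_rels_def Let_def\<close>)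
  also have "\<dots> = t a b \<oplus>\<^bsub>T\<^esub> t a' b"
    unfolding pure_tensor_def tensor_algebra_def by (rule cls) (use assms in auto)
  finally show ?thesis .
qed

lemma pure_tensor_add_right:
  assumes "a \<in> carrier A" "b \<in> carrier B" "b' \<in> carrier B"
  shows "t a (b \<oplus>\<^bsub>B\<^esub> b') = t a b \<oplus>\<^bsub>T\<^esub> t a b'"
proof -
  let ?x = "Poly_Mapping.single (a, b) 1" and ?y = "Poly_Mapping.single (a, b') 1"
  have c: "?x \<oplus>\<^bsub>P\<^esub> ?y \<in> carrier P" using assms by (intro P.a_closed single_closed)
  have "t a (b \<oplus>\<^bsub>B\<^esub> b') = quot_class P (tensor_rels A B) (?x \<oplus>\<^bsub>P\<^esub> ?y)"
    unfolding pure_tensor_def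
    by (rule rel_class_eq) (use assms c in \<open>auto simp: tensor_rels_def Let_def\<close>)
  also have "\<dots> = t a b \<oplus>\<^bsub>T\<^esub> t a b'"
    unfolding pure_tensor_def tensor_algebra_def by (rule cls) (use assms in auto)
  finally show ?thesis .
qed

lemma pure_tensor_smult_left:
  assumes "a \<in> carrier A" "b \<in> carrier B"
  shows "t (c \<odot>\<^bsub>A\<^esub> a) b = c \<odot>\<^bsub>T\<^esub> t a b"
proof -
  have "t (c \<odot>\<^bsub>A\<^esub> a) b = quot_class P (tensor_rels A B) (c \<odot>\<^bsub>P\<^esub> Poly_Mapping.single (a, b) 1)"
    unfolding pure_tensor_def
    by (rule rel_class_eq) (use assms in \<open>auto simp: tensor_rels_def Let_def\<close>)
  also have "\<dots> = c \<odot>\<^bsub>T\<^esub> t a b"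
    unfolding pure_tensor_def tensor_algebra_def by (rule cls) (use assms in auto)
  finally show ?thesis .
qed

lemma pure_tensor_smult_right:
  assumes "a \<in> carrier A" "b \<in> carrier B"
  shows "t a (c \<odot>\<^bsub>B\<^esub> b) = c \<odot>\<^bsub>T\<^esub> t a b"
proof -
  have "t a (c \<odot>\<^bsub>B\<^esub> b) = quot_class P (tensor_rels A B) (c \<odot>\<^bsub>P\<^esub> Poly_Mapping.single (a, b) 1)"
    unfolding pure_tensor_def
    by (rule rel_class_eq) (use assms in \<open>auto simp: tensor_rels_def Let_def\<close>)
  also have "\<dots> = c \<odot>\<^bsub>T\<^esub> t a b"
    unfolding pure_tensor_def tensor_algebra_def by (rule cls) (use assms in auto)
  finally show ?thesis .
qed

lemma pure_tensor_mult:
  assumes "a \<in> carrier A" "b \<in> carrier B" "a' \<in> carrier A" "b' \<in> carrier B"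
  shows "t a b \<otimes>\<^bsub>T\<^esub> t a' b' = t (a \<otimes>\<^bsub>A\<^esub> a') (b \<otimes>\<^bsub>B\<^esub> b')"
proof -
  have "t (a \<otimes>\<^bsub>A\<^esub> a') (b \<otimes>\<^bsub>B\<^esub> b')
      = quot_class P (tensor_rels A B) (Poly_Mapping.single (a, b) 1 \<otimes>\<^bsub>P\<^esub> Poly_Mapping.single (a', b') 1)"
    by (simp add: pure_tensor_def)
  also have "\<dots> = t a b \<otimes>\<^bsub>T\<^esub> t a' b'"
    unfolding pure_tensor_def tensor_algebra_def by (rule cls) (use assms in auto)
  finally show ?thesis ..
qed

lemma pure_tensor_one: "t \<one>\<^bsub>A\<^esub> \<one>\<^bsub>B\<^esub> = \<one>\<^bsub>T\<^esub>"
  using cls(4) by (simp add: pure_tensor_def tensor_algebra_def)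

end

subsection \<open>The coproduct is a well-defined algebra homomorphism\<close>

lemma complex_algebra_Uq: "complex_algebra (Uq h)"
  unfolding Uq_def by (rule complex_algebra.complex_algebra_quot[OF complex_algebra_free]) simp

lemma complex_algebra_Uq2: "complex_algebra (Uq2 h)"
  unfolding Uq2_def
  by (intro two_algebras.complex_algebra_tensor two_algebras.intro complex_algebra_Uq)

text \<open>The family \<open>f\<close> of elements of \<open>A\<close> satisfies the defining relations of \<open>U_q(su(1,1))\<close>.\<close>

definition uq_family :: "complex \<Rightarrow> (complex, 'a) module \<Rightarrow> (uq_gen \<Rightarrow> 'a) \<Rightarrow> bool" where
  "uq_family h A f \<longleftrightarrow>
    range f \<subseteq> carrier A \<and>
    commutator A (f Gen_zero) (f Gen_plus) = f Gen_plus \<and>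
    commutator A (f Gen_zero) (f Gen_minus) = \<ominus>\<^bsub>A\<^esub> f Gen_minus \<and>
    f Gen_minus \<otimes>\<^bsub>A\<^esub> f Gen_plus \<ominus>\<^bsub>A\<^esub> (exp h)\<^sup>2 \<odot>\<^bsub>A\<^esub> (f Gen_plus \<otimes>\<^bsub>A\<^esub> f Gen_minus)
      = f (Gen_exp 2) \<otimes>\<^bsub>A\<^esub> q_bracket A (exp h) (\<lambda>l. f (Gen_exp l)) 2 \<and>
    f (Gen_exp 0) = \<one>\<^bsub>A\<^esub> \<and>
    (\<forall>l. commutator A (f Gen_zero) (f (Gen_exp l)) = \<zero>\<^bsub>A\<^esub>) \<and>
    (\<forall>l. f (Gen_exp l) \<otimes>\<^bsub>A\<^esub> f Gen_plus = exp (h * l) \<odot>\<^bsub>A\<^esub> (f Gen_plus \<otimes>\<^bsub>A\<^esub> f (Gen_exp l))) \<and>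
    (\<forall>l. f (Gen_exp l) \<otimes>\<^bsub>A\<^esub> f Gen_minus = exp (h * - l) \<odot>\<^bsub>A\<^esub> (f Gen_minus \<otimes>\<^bsub>A\<^esub> f (Gen_exp l))) \<and>
    (\<forall>l m. f (Gen_exp (l + m)) = f (Gen_exp l) \<otimes>\<^bsub>A\<^esub> f (Gen_exp m))"

lemma (in complex_algebra) minus_eq_zero_iff:
  "x \<in> carrier A \<Longrightarrow> y \<in> carrier A \<Longrightarrow> x \<ominus> y = \<zero> \<longleftrightarrow> x = y"
  by (metis minus_equality minus_minus minus_eq a_inv_closed r_neg)

lemma (in complex_algebra) plus_eq_zero_iff:
  "x \<in> carrier A \<Longrightarrow> y \<in> carrier A \<Longrightarrow> x \<oplus> y = \<zero> \<longleftrightarrow> x = \<ominus> y"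
  by (metis minus_equality minus_minus a_comm l_neg)

lemma uq_family_iff:
  assumes f: "F \<in> algebra_hom free_algebra A" and A: "complex_algebra A"
  shows "(\<forall>r\<in>uq_rels h. F r = \<zero>\<^bsub>A\<^esub>) \<longleftrightarrow> uq_family h A (\<lambda>g. F (free_gen g))"
proof -
  interpret A: complex_algebra A by fact
  interpret R: complex_algebra free_algebra by (rule complex_algebra_free)
  note h = algebra_homD[OF f, simplified] algebra_hom_minus[OF f complex_algebra_free A, simplified]
  note c = h(1)
  show ?thesis
    unfolding uq_rels_def uq_family_def Let_def commutator_def q_bracket_def
    by (simp add: h c A.minus_eq_zero_iff A.plus_eq_zero_iff image_subset_iff ball_Un) auto
qed

lemma uq_family_uq_gen: "uq_family h (Uq h) (uq_gen h)"
proof -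
  interpret R: complex_algebra free_algebra by (rule complex_algebra_free)
  have S: "uq_rels h \<subseteq> carrier free_algebra" by simp
  have "quot_class free_algebra (uq_rels h) r = \<zero>\<^bsub>Uq h\<^esub>" if "r \<in> uq_rels h" for r
  proof -
    have "quot_class free_algebra (uq_rels h) r = quot_class free_algebra (uq_rels h) \<zero>\<^bsub>free_algebra\<^esub>"
      using that R.genideal_self[OF S] by (subst R.quot_class_eq_iff[OF S]) (auto simp: R.minus_eq)
    also have "\<dots> = \<zero>\<^bsub>Uq h\<^esub>"
      using R.quot_class_smult[OF S, of "\<zero>\<^bsub>free_algebra\<^esub>" 0]
        complex_algebra.smult_zero_left[OF complex_algebra_Uq[of h], of "quot_class free_algebra (uq_rels h) \<zero>\<^bsub>free_algebra\<^esub>"]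
        R.quot_class_closed[OF S, of "\<zero>\<^bsub>free_algebra\<^esub>"]
      by (simp add: Uq_def)
    finally show ?thesis .
  qed
  then show ?thesis
    using uq_family_iff[OF R.quot_class_hom[OF S], of h] complex_algebra_Uq[of h]
    by (simp add: Uq_def uq_gen_def[abs_def])
qed

lemma uq_gen_closed [simp]: "uq_gen h g \<in> carrier (Uq h)"
  using uq_family_uq_gen[of h] by (auto simp: uq_family_def)

lemma qJ_zero [simp]: "qJ h l 0 = uq_gen h (Gen_exp l)"
  by (simp add: qJ_def complex_algebra.smult_one[OF complex_algebra_Uq])

lemma uq_family_coproduct_gen: "uq_family h (Uq2 h) (coproduct_gen h)"
proof -
  interpret U: complex_algebra "Uq h" by (rule complex_algebra_Uq)
  interpret TA: two_algebras "Uq h" "Uq h" ..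
  interpret T: complex_algebra "Uq2 h" by (rule complex_algebra_Uq2)
  define x y z E where xyz: "x = uq_gen h Gen_zero" "y = uq_gen h Gen_plus" "z = uq_gen h Gen_minus"
    "E = (\<lambda>l. uq_gen h (Gen_exp l))"
  define k where "k = 1 / (exp h - inverse (exp h))"
  have c [simp]: "x \<in> carrier (Uq h)" "y \<in> carrier (Uq h)" "z \<in> carrier (Uq h)" "E l \<in> carrier (Uq h)" for l
    by (auto simp: xyz)
  have tc [simp]: "a \<in> carrier (Uq h) \<Longrightarrow> b \<in> carrier (Uq h) \<Longrightarrow> tens h a b \<in> carrier (Uq2 h)" for a b
    by (simp add: tens_def Uq2_def)
  note tl = TA.pure_tensor_add_left[folded Uq2_def tens_def]
    TA.pure_tensor_add_right[folded Uq2_def tens_def]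
    TA.pure_tensor_smult_left[folded Uq2_def tens_def]
    TA.pure_tensor_smult_right[folded Uq2_def tens_def]
  note tm = TA.pure_tensor_mult[folded Uq2_def tens_def]
  note t1 = TA.pure_tensor_one[folded Uq2_def tens_def]
  have tneg: "tens h (\<ominus>\<^bsub>Uq h\<^esub> a) b = \<ominus>\<^bsub>Uq2 h\<^esub> tens h a b" "tens h a (\<ominus>\<^bsub>Uq h\<^esub> b) = \<ominus>\<^bsub>Uq2 h\<^esub> tens h a b"
    if "a \<in> carrier (Uq h)" "b \<in> carrier (Uq h)" for a b
  proof -
    have n: "(- 1) \<odot>\<^bsub>A\<^esub> v = \<ominus>\<^bsub>A\<^esub> v" if "complex_algebra A" "v \<in> carrier A" for A :: "(complex, 'z) module" and v
    proof -
      interpret complex_algebra A by fact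
      have "(- 1) \<odot>\<^bsub>A\<^esub> v \<oplus>\<^bsub>A\<^esub> v = \<zero>\<^bsub>A\<^esub>"
        using smult_l_distr[of v "- 1" 1] that(2) by simp
      then show ?thesis using that(2) by (metis minus_equality smult_closed minus_minus a_comm)
    qed
    show "tens h (\<ominus>\<^bsub>Uq h\<^esub> a) b = \<ominus>\<^bsub>Uq2 h\<^esub> tens h a b" "tens h a (\<ominus>\<^bsub>Uq h\<^esub> b) = \<ominus>\<^bsub>Uq2 h\<^esub> tens h a b"
      using that by (simp_all add: tl flip: n[OF complex_algebra_Uq] n[OF complex_algebra_Uq2])
  qed
  note fam = uq_family_uq_gen[of h, unfolded uq_family_def commutator_def q_bracket_def, folded xyz k_def]
  have sub: "a = b \<oplus>\<^bsub>A\<^esub> d" if "a \<ominus>\<^bsub>A\<^esub> b = d" "complex_algebra A" "a \<in> carrier A" "b \<in> carrier A"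
    for A :: "(complex, 'z) module" and a b d
  proof -
    interpret complex_algebra A by fact
    show ?thesis using that by (simp add: minus_eq a_comm a_lcomm r_neg flip: that(1))
  qed
  have xy: "x \<otimes>\<^bsub>Uq h\<^esub> y = y \<otimes>\<^bsub>Uq h\<^esub> x \<oplus>\<^bsub>Uq h\<^esub> y"
    by (rule sub[OF _ complex_algebra_Uq]) (use fam in \<open>auto simp: xyz\<close>)
  have xz: "x \<otimes>\<^bsub>Uq h\<^esub> z = z \<otimes>\<^bsub>Uq h\<^esub> x \<oplus>\<^bsub>Uq h\<^esub> \<ominus>\<^bsub>Uq h\<^esub> z"
    by (rule sub[OF _ complex_algebra_Uq]) (use fam in \<open>auto simp: xyz\<close>)
  have EE: "E l \<otimes>\<^bsub>Uq h\<^esub> E m = E (l + m)" for l m using fam by (auto simp: xyz)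
  have E0: "E 0 = \<one>\<^bsub>Uq h\<^esub>" using fam by (auto simp: xyz)
  have Ey: "E l \<otimes>\<^bsub>Uq h\<^esub> y = exp (h * l) \<odot>\<^bsub>Uq h\<^esub> (y \<otimes>\<^bsub>Uq h\<^esub> E l)" for l using fam by (auto simp: xyz)
  have Ez: "E l \<otimes>\<^bsub>Uq h\<^esub> z = exp (h * - l) \<odot>\<^bsub>Uq h\<^esub> (z \<otimes>\<^bsub>Uq h\<^esub> E l)" for l using fam by (auto simp: xyz)
  have xE: "x \<otimes>\<^bsub>Uq h\<^esub> E l = E l \<otimes>\<^bsub>Uq h\<^esub> x" for l
    using fam by (auto simp: xyz U.minus_eq_zero_iff)
  have "z \<otimes>\<^bsub>Uq h\<^esub> y = (exp h)\<^sup>2 \<odot>\<^bsub>Uq h\<^esub> (y \<otimes>\<^bsub>Uq h\<^esub> z) \<oplus>\<^bsub>Uq h\<^esub> (E 2 \<otimes>\<^bsub>Uq h\<^esub> (k \<odot>\<^bsub>Uq h\<^esub> (E 2 \<ominus>\<^bsub>Uq h\<^esub> E (- 2))))"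
    by (rule sub[OF _ complex_algebra_Uq]) (use fam in \<open>auto simp: xyz\<close>)
  then have zy: "z \<otimes>\<^bsub>Uq h\<^esub> y = (exp h)\<^sup>2 \<odot>\<^bsub>Uq h\<^esub> (y \<otimes>\<^bsub>Uq h\<^esub> z) \<oplus>\<^bsub>Uq h\<^esub> (k \<odot>\<^bsub>Uq h\<^esub> (E 4 \<oplus>\<^bsub>Uq h\<^esub> \<ominus>\<^bsub>Uq h\<^esub> \<one>\<^bsub>Uq h\<^esub>))"
    by (simp add: U.smult_mult_r U.minus_eq U.r_distr U.r_minus EE E0)
  have gens: "coproduct_gen h Gen_zero = tens h x \<one>\<^bsub>Uq h\<^esub> \<oplus>\<^bsub>Uq2 h\<^esub> tens h \<one>\<^bsub>Uq h\<^esub> x"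
    "coproduct_gen h Gen_plus = tens h y (E 2) \<oplus>\<^bsub>Uq2 h\<^esub> tens h \<one>\<^bsub>Uq h\<^esub> y"
    "coproduct_gen h Gen_minus = tens h z (E 2) \<oplus>\<^bsub>Uq2 h\<^esub> tens h \<one>\<^bsub>Uq h\<^esub> z"
    "coproduct_gen h (Gen_exp l) = tens h (E l) (E l)" for l
    by (simp_all add: xyz J0_def Jp_def Jm_def)
  have e2: "exp (2 * h) = (exp h)\<^sup>2" "exp (h * 2) = (exp h)\<^sup>2" by (simp_all add: exp_double mult.commute[of h 2])
  have e3: "exp (h * - l) * exp (h * l) = 1" "exp (- (h * l)) * exp (h * l) = 1" "exp (h * l) * exp (- (h * l)) = 1" for l
    by (simp_all flip: exp_add)
  have subI: "u \<ominus>\<^bsub>Uq2 h\<^esub> v = w"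
    if "u = w \<oplus>\<^bsub>Uq2 h\<^esub> v" "v \<in> carrier (Uq2 h)" "w \<in> carrier (Uq2 h)" for u v w
    using that by (simp add: T.minus_eq T.a_assoc T.r_neg)
  have can7: "(a \<oplus>\<^bsub>Uq2 h\<^esub> (f \<oplus>\<^bsub>Uq2 h\<^esub> \<ominus>\<^bsub>Uq2 h\<^esub> g)) \<oplus>\<^bsub>Uq2 h\<^esub> b \<oplus>\<^bsub>Uq2 h\<^esub> (d \<oplus>\<^bsub>Uq2 h\<^esub> (e \<oplus>\<^bsub>Uq2 h\<^esub> (g \<oplus>\<^bsub>Uq2 h\<^esub> \<ominus>\<^bsub>Uq2 h\<^esub> u)))
      \<ominus>\<^bsub>Uq2 h\<^esub> (a \<oplus>\<^bsub>Uq2 h\<^esub> d \<oplus>\<^bsub>Uq2 h\<^esub> (b \<oplus>\<^bsub>Uq2 h\<^esub> e)) = f \<ominus>\<^bsub>Uq2 h\<^esub> u"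
    if i [simp]: "a \<in> carrier (Uq2 h)" "b \<in> carrier (Uq2 h)" "d \<in> carrier (Uq2 h)" "e \<in> carrier (Uq2 h)"
      "f \<in> carrier (Uq2 h)" "g \<in> carrier (Uq2 h)" "u \<in> carrier (Uq2 h)" for a b d e f g u
  proof -
    have 1: "(f \<oplus>\<^bsub>Uq2 h\<^esub> \<ominus>\<^bsub>Uq2 h\<^esub> g) \<oplus>\<^bsub>Uq2 h\<^esub> (g \<oplus>\<^bsub>Uq2 h\<^esub> \<ominus>\<^bsub>Uq2 h\<^esub> u) = f \<ominus>\<^bsub>Uq2 h\<^esub> u"
      by (simp add: T.a_assoc T.minus_eq T.r_neg1)
    define m where "m = \<ominus>\<^bsub>Uq2 h\<^esub> g"
    define n where "n = \<ominus>\<^bsub>Uq2 h\<^esub> u"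
    have [simp]: "m \<in> carrier (Uq2 h)" "n \<in> carrier (Uq2 h)" by (auto simp: m_def n_def)
    have 2: "(a \<oplus>\<^bsub>Uq2 h\<^esub> (f \<oplus>\<^bsub>Uq2 h\<^esub> m)) \<oplus>\<^bsub>Uq2 h\<^esub> b \<oplus>\<^bsub>Uq2 h\<^esub> (d \<oplus>\<^bsub>Uq2 h\<^esub> (e \<oplus>\<^bsub>Uq2 h\<^esub> (g \<oplus>\<^bsub>Uq2 h\<^esub> n)))
        = ((f \<oplus>\<^bsub>Uq2 h\<^esub> m) \<oplus>\<^bsub>Uq2 h\<^esub> (g \<oplus>\<^bsub>Uq2 h\<^esub> n)) \<oplus>\<^bsub>Uq2 h\<^esub> (a \<oplus>\<^bsub>Uq2 h\<^esub> d \<oplus>\<^bsub>Uq2 h\<^esub> (b \<oplus>\<^bsub>Uq2 h\<^esub> e))"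
      by (simp add: T.a_assoc T.a_comm T.a_lcomm)
    have 3: "(v \<oplus>\<^bsub>Uq2 h\<^esub> w) \<ominus>\<^bsub>Uq2 h\<^esub> w = v" if "v \<in> carrier (Uq2 h)" "w \<in> carrier (Uq2 h)" for v w
      using that by (simp add: T.minus_eq T.a_assoc T.r_neg)
    show ?thesis unfolding 2[unfolded m_def n_def] 1 by (rule 3) auto
  qed
  note sm = T.smult_mult_l T.smult_mult_r U.smult_mult_l U.smult_mult_r T.smult_r_distr U.smult_r_distr
  note ex = T.l_distr T.r_distr tm tl tneg U.l_minus U.r_minus T.l_minus T.r_minus T.minus_add
  define q2 where "q2 = (exp h)\<^sup>2"
  have q3: "q2 * exp (- (h * 2)) = 1" "exp (- (h * 2)) * q2 = 1" "q2 * exp (- (2 * h)) = 1"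
    by (simp_all add: q2_def exp_minus mult.commute[of h 2] flip: exp_double)
  have cc: "coproduct_gen h g \<in> carrier (Uq2 h)" for g
    by (cases g) (auto simp: gens simp del: coproduct_gen.simps)
  show ?thesis
    unfolding uq_family_def commutator_def q_bracket_def gens k_def[symmetric]
  proof (intro conjI allI)
    show "range (coproduct_gen h) \<subseteq> carrier (Uq2 h)" using cc by blast
    show "tens h (E 0) (E 0) = \<one>\<^bsub>Uq2 h\<^esub>" by (simp add: E0 t1)
    show "tens h (E (l + m)) (E (l + m)) = tens h (E l) (E l) \<otimes>\<^bsub>Uq2 h\<^esub> tens h (E m) (E m)" for l m
      by (simp add: tm EE)
    show "(tens h x \<one>\<^bsub>Uq h\<^esub> \<oplus>\<^bsub>Uq2 h\<^esub> tens h \<one>\<^bsub>Uq h\<^esub> x) \<otimes>\<^bsub>Uq2 h\<^esub> tens h (E l) (E l) \<ominus>\<^bsub>Uq2 h\<^esub>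
         tens h (E l) (E l) \<otimes>\<^bsub>Uq2 h\<^esub> (tens h x \<one>\<^bsub>Uq h\<^esub> \<oplus>\<^bsub>Uq2 h\<^esub> tens h \<one>\<^bsub>Uq h\<^esub> x) = \<zero>\<^bsub>Uq2 h\<^esub>" for l
      by (simp add: ex xE T.minus_eq_zero_iff)
    show "tens h (E l) (E l) \<otimes>\<^bsub>Uq2 h\<^esub> (tens h y (E 2) \<oplus>\<^bsub>Uq2 h\<^esub> tens h \<one>\<^bsub>Uq h\<^esub> y) =
         exp (h * l) \<odot>\<^bsub>Uq2 h\<^esub> ((tens h y (E 2) \<oplus>\<^bsub>Uq2 h\<^esub> tens h \<one>\<^bsub>Uq h\<^esub> y) \<otimes>\<^bsub>Uq2 h\<^esub> tens h (E l) (E l))" for l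
      by (simp add: ex Ey EE sm add.commute[of l])
    show "tens h (E l) (E l) \<otimes>\<^bsub>Uq2 h\<^esub> (tens h z (E 2) \<oplus>\<^bsub>Uq2 h\<^esub> tens h \<one>\<^bsub>Uq h\<^esub> z) =
         exp (h * - l) \<odot>\<^bsub>Uq2 h\<^esub> ((tens h z (E 2) \<oplus>\<^bsub>Uq2 h\<^esub> tens h \<one>\<^bsub>Uq h\<^esub> z) \<otimes>\<^bsub>Uq2 h\<^esub> tens h (E l) (E l))" for l
      by (simp add: ex Ez EE sm add.commute[of l])
    show "(tens h x \<one>\<^bsub>Uq h\<^esub> \<oplus>\<^bsub>Uq2 h\<^esub> tens h \<one>\<^bsub>Uq h\<^esub> x) \<otimes>\<^bsub>Uq2 h\<^esub> (tens h y (E 2) \<oplus>\<^bsub>Uq2 h\<^esub> tens h \<one>\<^bsub>Uq h\<^esub> y) \<ominus>\<^bsub>Uq2 h\<^esub>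
        (tens h y (E 2) \<oplus>\<^bsub>Uq2 h\<^esub> tens h \<one>\<^bsub>Uq h\<^esub> y) \<otimes>\<^bsub>Uq2 h\<^esub> (tens h x \<one>\<^bsub>Uq h\<^esub> \<oplus>\<^bsub>Uq2 h\<^esub> tens h \<one>\<^bsub>Uq h\<^esub> x) =
        tens h y (E 2) \<oplus>\<^bsub>Uq2 h\<^esub> tens h \<one>\<^bsub>Uq h\<^esub> y"
      by (rule subI) (simp_all add: ex xE xy T.a_assoc T.a_comm T.a_lcomm)
    show "(tens h x \<one>\<^bsub>Uq h\<^esub> \<oplus>\<^bsub>Uq2 h\<^esub> tens h \<one>\<^bsub>Uq h\<^esub> x) \<otimes>\<^bsub>Uq2 h\<^esub> (tens h z (E 2) \<oplus>\<^bsub>Uq2 h\<^esub> tens h \<one>\<^bsub>Uq h\<^esub> z) \<ominus>\<^bsub>Uq2 h\<^esub>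
        (tens h z (E 2) \<oplus>\<^bsub>Uq2 h\<^esub> tens h \<one>\<^bsub>Uq h\<^esub> z) \<otimes>\<^bsub>Uq2 h\<^esub> (tens h x \<one>\<^bsub>Uq h\<^esub> \<oplus>\<^bsub>Uq2 h\<^esub> tens h \<one>\<^bsub>Uq h\<^esub> x) =
        \<ominus>\<^bsub>Uq2 h\<^esub> (tens h z (E 2) \<oplus>\<^bsub>Uq2 h\<^esub> tens h \<one>\<^bsub>Uq h\<^esub> z)"
      by (rule subI) (simp_all add: ex xE xz T.a_assoc T.a_comm T.a_lcomm)
    show "(tens h z (E 2) \<oplus>\<^bsub>Uq2 h\<^esub> tens h \<one>\<^bsub>Uq h\<^esub> z) \<otimes>\<^bsub>Uq2 h\<^esub> (tens h y (E 2) \<oplus>\<^bsub>Uq2 h\<^esub> tens h \<one>\<^bsub>Uq h\<^esub> y) \<ominus>\<^bsub>Uq2 h\<^esub>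
        (exp h)\<^sup>2 \<odot>\<^bsub>Uq2 h\<^esub> ((tens h y (E 2) \<oplus>\<^bsub>Uq2 h\<^esub> tens h \<one>\<^bsub>Uq h\<^esub> y) \<otimes>\<^bsub>Uq2 h\<^esub> (tens h z (E 2) \<oplus>\<^bsub>Uq2 h\<^esub> tens h \<one>\<^bsub>Uq h\<^esub> z)) =
        tens h (E 2) (E 2) \<otimes>\<^bsub>Uq2 h\<^esub> (k \<odot>\<^bsub>Uq2 h\<^esub> (tens h (E 2) (E 2) \<ominus>\<^bsub>Uq2 h\<^esub> tens h (E (- 2)) (E (- 2))))"
    proof -
      have 1: "(tens h z (E 2) \<oplus>\<^bsub>Uq2 h\<^esub> tens h \<one>\<^bsub>Uq h\<^esub> z) \<otimes>\<^bsub>Uq2 h\<^esub> (tens h y (E 2) \<oplus>\<^bsub>Uq2 h\<^esub> tens h \<one>\<^bsub>Uq h\<^esub> y)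
        = (q2 \<odot>\<^bsub>Uq2 h\<^esub> tens h (y \<otimes>\<^bsub>Uq h\<^esub> z) (E 4) \<oplus>\<^bsub>Uq2 h\<^esub> (k \<odot>\<^bsub>Uq2 h\<^esub> tens h (E 4) (E 4) \<oplus>\<^bsub>Uq2 h\<^esub> \<ominus>\<^bsub>Uq2 h\<^esub> (k \<odot>\<^bsub>Uq2 h\<^esub> tens h \<one>\<^bsub>Uq h\<^esub> (E 4))))
          \<oplus>\<^bsub>Uq2 h\<^esub> q2 \<odot>\<^bsub>Uq2 h\<^esub> tens h z (y \<otimes>\<^bsub>Uq h\<^esub> E 2) \<oplus>\<^bsub>Uq2 h\<^esub> (tens h y (z \<otimes>\<^bsub>Uq h\<^esub> E 2) \<oplus>\<^bsub>Uq2 h\<^esub>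
            (q2 \<odot>\<^bsub>Uq2 h\<^esub> tens h \<one>\<^bsub>Uq h\<^esub> (y \<otimes>\<^bsub>Uq h\<^esub> z) \<oplus>\<^bsub>Uq2 h\<^esub> (k \<odot>\<^bsub>Uq2 h\<^esub> tens h \<one>\<^bsub>Uq h\<^esub> (E 4) \<oplus>\<^bsub>Uq2 h\<^esub> \<ominus>\<^bsub>Uq2 h\<^esub> (k \<odot>\<^bsub>Uq2 h\<^esub> tens h \<one>\<^bsub>Uq h\<^esub> \<one>\<^bsub>Uq h\<^esub>))))"
        unfolding q2_def by (simp add: ex Ey EE zy sm e2 U.smult_minus T.smult_minus T.a_assoc T.a_comm T.a_lcomm)
      have 2: "q2 \<odot>\<^bsub>Uq2 h\<^esub> ((tens h y (E 2) \<oplus>\<^bsub>Uq2 h\<^esub> tens h \<one>\<^bsub>Uq h\<^esub> y) \<otimes>\<^bsub>Uq2 h\<^esub> (tens h z (E 2) \<oplus>\<^bsub>Uq2 h\<^esub> tens h \<one>\<^bsub>Uq h\<^esub> z))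
        = q2 \<odot>\<^bsub>Uq2 h\<^esub> tens h (y \<otimes>\<^bsub>Uq h\<^esub> z) (E 4) \<oplus>\<^bsub>Uq2 h\<^esub> tens h y (z \<otimes>\<^bsub>Uq h\<^esub> E 2) \<oplus>\<^bsub>Uq2 h\<^esub>
           (q2 \<odot>\<^bsub>Uq2 h\<^esub> tens h z (y \<otimes>\<^bsub>Uq h\<^esub> E 2) \<oplus>\<^bsub>Uq2 h\<^esub> q2 \<odot>\<^bsub>Uq2 h\<^esub> tens h \<one>\<^bsub>Uq h\<^esub> (y \<otimes>\<^bsub>Uq h\<^esub> z))"
        by (simp add: ex Ez EE sm q3 T.a_assoc T.a_comm T.a_lcomm flip: T.smult_assoc)
      have 3: "tens h (E 2) (E 2) \<otimes>\<^bsub>Uq2 h\<^esub> (k \<odot>\<^bsub>Uq2 h\<^esub> (tens h (E 2) (E 2) \<ominus>\<^bsub>Uq2 h\<^esub> tens h (E (- 2)) (E (- 2))))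
        = k \<odot>\<^bsub>Uq2 h\<^esub> tens h (E 4) (E 4) \<ominus>\<^bsub>Uq2 h\<^esub> k \<odot>\<^bsub>Uq2 h\<^esub> tens h \<one>\<^bsub>Uq h\<^esub> \<one>\<^bsub>Uq h\<^esub>"
        by (simp add: ex EE E0 sm T.minus_eq T.smult_minus)
      show ?thesis unfolding q2_def[symmetric] 1 2 3 by (rule can7) auto
    qed
  qed
qed

lemma coproduct_gen_closed: "coproduct_gen h g \<in> carrier (Uq2 h)"
  using uq_family_coproduct_gen[of h] by (auto simp: uq_family_def)

lemma coproduct_quot:
  "coproduct h (quot_class free_algebra (uq_rels h) p) = free_eval (Uq2 h) (coproduct_gen h) p"
  and coproduct_hom: "coproduct h \<in> algebra_hom (Uq h) (Uq2 h)"
proof -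
  interpret T: complex_algebra "Uq2 h" by (rule complex_algebra_Uq2)
  have f: "free_eval (Uq2 h) (coproduct_gen h) \<in> algebra_hom free_algebra (Uq2 h)"
    by (rule T.free_eval_hom) (rule coproduct_gen_closed)
  have "(\<lambda>g. free_eval (Uq2 h) (coproduct_gen h) (free_gen g)) = coproduct_gen h"
    by (simp add: T.free_eval_gen coproduct_gen_closed)
  then have z: "free_eval (Uq2 h) (coproduct_gen h) r = \<zero>\<^bsub>Uq2 h\<^esub>" if "r \<in> uq_rels h" for r
    using uq_family_iff[OF f complex_algebra_Uq2, of h] uq_family_coproduct_gen[of h] that by simp
  show "coproduct h (quot_class free_algebra (uq_rels h) p) = free_eval (Uq2 h) (coproduct_gen h) p"
    unfolding coproduct_def by (rule quot_lift_eq[OF f complex_algebra_free complex_algebra_Uq2 _ z]) auto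
  show "coproduct h \<in> algebra_hom (Uq h) (Uq2 h)"
    unfolding coproduct_def Uq_def
    by (rule quot_lift_hom[OF f complex_algebra_free complex_algebra_Uq2 _ z]) auto
qed

lemma coproduct_uq_gen: "coproduct h (uq_gen h g) = coproduct_gen h g"
  by (simp add: uq_gen_def coproduct_quot coproduct_gen_closed
      complex_algebra.free_eval_gen[OF complex_algebra_Uq2])

end

(*
  Put X = q^J0 (x) q^-J0 and N = 2 K2 = Delta(C), and let L = q^J0 (x) q^J0.  The four-term expression
  for Delta(C) reads N = c + beta X^-1 + c X^-2 + P + M, where P ~ J+ (x) J- and M ~ J- (x) J+
  satisfy X P = q^2 P X and X M = q^-2 M X, and beta is built from the two Casimir elements and L.
  Everything that occurs commutes with Delta(J0), so C (x) 1, 1 (x) C and L are central parameters,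
  and since J+ J- and J- J+ are polynomials in q^(2 J0) over the Casimir element, P M and M P are
  polynomials in X^-1.  Hence X and N live in a graded algebra with finitely many explicit
  monomials, in which the two cubic relations

    X^2 N - (q^2 + q^-2) X N X + N X^2  =  - (q - q^-1)^2 (c X^2 + beta X + c),
    X N^2 - (q^2 + q^-2) N X N + N^2 X  =  - (1 + q^-2) (X N + N X) - (q - q^-1)^2 beta N
                                           + (1 + q^-2) (beta - beta')

  are checked degree by degree.  With K1 affine in X they are the Askey-Wilson relations; the
  constant c and the polynomials beta, beta' account for xi_7 and xi_5.
*)

theory Submission
  imports Defs
begin

section \<open>Normal forms in a complex algebra\<close>

context complex_algebra begin

text \<open>Coefficients sit in a list so that two sums over the same monomials can be compared
  entry by entry. Equal coefficients suffice for equal sums, so the monomials may be linearly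
  dependent.\<close>

fun lincomb :: "complex list \<Rightarrow> 'a list \<Rightarrow> 'a" where
  "lincomb (c # cs) (m # ms) = c \<odot> m \<oplus> lincomb cs ms"
| "lincomb _ _ = \<zero>"

lemma lincomb_closed: "set ms \<subseteq> carrier A \<Longrightarrow> lincomb cs ms \<in> carrier A"
  by (induction cs ms rule: lincomb.induct) auto

text \<open>The lengths must agree because \<open>map2\<close> stops at the end of the shorter
  list.\<close>

lemma lincomb_add:
  "length cs = length ds \<Longrightarrow> set ms \<subseteq> carrier A \<Longrightarrow>
    lincomb cs ms \<oplus> lincomb ds ms = lincomb (map2 (+) cs ds) ms"
proof (induction cs ds arbitrary: ms rule: list_induct2)
  case (Cons c cs d ds)
  show ?case
  proof (cases ms)
    case (Cons m ns)
    with Cons.prems Cons.IH[of ns, symmetric] show ?thesis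
      by (simp add: lincomb_closed smult_l_distr a_assoc a_lcomm)
  qed simp
qed simp

lemma lincomb_smult:
  "set ms \<subseteq> carrier A \<Longrightarrow> k \<odot> lincomb cs ms = lincomb (map ((*) k) cs) ms"
  by (induction cs ms rule: lincomb.induct) (auto simp: lincomb_closed smult_r_distr smult_assoc)

lemma lincomb_cong: "cs = ds \<Longrightarrow> lincomb cs ms = lincomb ds ms" by simp

lemma minus_eq_smult: "x \<in> carrier A \<Longrightarrow> \<ominus> x = (- 1) \<odot> x"
  using smult_l_distr[of x "- 1" 1] minus_equality[of "(- 1) \<odot> x" x] by simp

lemma diff_eq_smult: "x \<in> carrier A \<Longrightarrow> y \<in> carrier A \<Longrightarrow> x \<ominus> y = x \<oplus> (- 1) \<odot> y"
  by (simp add: minus_eq minus_eq_smult)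

text \<open>Products are kept bracketed to the right, so each exchange rule needs a variant acting
  on the first two factors of a longer product.\<close>

lemma left_commute_smult:
  assumes "u \<otimes> v = k \<odot> (v \<otimes> u)" "u \<in> carrier A" "v \<in> carrier A" "w \<in> carrier A"
  shows "u \<otimes> (v \<otimes> w) = k \<odot> (v \<otimes> (u \<otimes> w))"
  using assms by (metis m_assoc m_closed smult_mult_l)

lemma left_commute_eq:
  assumes "u \<otimes> v = v \<otimes> u" "u \<in> carrier A" "v \<in> carrier A" "w \<in> carrier A"
  shows "u \<otimes> (v \<otimes> w) = v \<otimes> (u \<otimes> w)"
  using assms by (metis m_assoc)

lemma left_mult_eq:
  assumes "u \<otimes> v = w" "u \<in> carrier A" "v \<in> carrier A" "z \<in> carrier A"
  shows "u \<otimes> (v \<otimes> z) = w \<otimes> z"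
  using assms by (metis m_assoc)

lemma minus_eq_imp_eq: "x \<ominus> y = z \<Longrightarrow> x \<in> carrier A \<Longrightarrow> y \<in> carrier A \<Longrightarrow> x = y \<oplus> z"
  by (metis a_assoc a_comm a_inv_closed l_neg l_zero minus_eq)

text \<open>Serves to turn the two cubic relations into rewrite rules for
  \<open>N \<otimes> (N \<otimes> X)\<close> and \<open>N \<otimes> (X \<otimes> X)\<close>.\<close>

lemma add_eq_imp_eq: "z \<oplus> x = y \<Longrightarrow> x \<in> carrier A \<Longrightarrow> z \<in> carrier A \<Longrightarrow> x = y \<oplus> (- 1) \<odot> z"
  by (metis a_comm a_assoc a_inv_closed r_neg r_zero minus_eq_smult)

lemma square_eq: "x \<in> carrier A \<Longrightarrow> x [^] (2::nat) = x \<otimes> x"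
  by (simp add: numeral_2_eq_2)

text \<open>Identities are verified by reducing both sides to \<^const>\<open>lincomb\<close> over a fixed list of normal
  monomials and comparing coefficients.  Every monomial must carry a coefficient, possibly \<open>1\<close>, so that
  the rules \<open>k \<odot> m = lincomb \<dots>\<close> apply to whole monomials only and never to their factors; this is why
  \<open>smult_one\<close> is switched off below and why some statements contain \<open>1 \<odot> x\<close>.\<close>

lemmas expand_simps = diff_eq_smult minus_eq_smult l_distr r_distr smult_r_distr smult_mult_l smult_mult_r
  smult_assoc[symmetric] m_assoc

end

text \<open>Replaces the defining fractions by polynomial relations between \<open>q\<close>, its
  inverse, \<open>a\<close> and \<open>c\<close>, so that coefficient identities become problems for
  Groebner bases.\<close>

lemma casimir_scalars:
  fixes q a c :: complex
  assumes "q \<noteq> 0" "q\<^sup>2 \<noteq> 1" "a = q / (q\<^sup>2 - 1)\<^sup>2" "c = (q\<^sup>2 + 1) / (q\<^sup>2 - 1)\<^sup>2"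
  shows "q * inverse q = 1" "a * (q - inverse q)\<^sup>2 = inverse q" "c = a * (q + inverse q)"
    "q / (q\<^sup>2 - 1) = a * (q\<^sup>2 - 1)"
proof -
  show *: "q * inverse q = 1" using assms by simp
  have "(q\<^sup>2 - 1)\<^sup>2 * a = q" "(q\<^sup>2 - 1)\<^sup>2 * c = q\<^sup>2 + 1" "q\<^sup>2 - 1 \<noteq> 0"
    using assms by simp_all
  with * show "a * (q - inverse q)\<^sup>2 = inverse q" "c = a * (q + inverse q)"
    by Groebner_Basis.algebra+ \<comment> \<open>unqualified, \<open>algebra\<close> is the method of HOL-Algebra\<close>
  show "q / (q\<^sup>2 - 1) = a * (q\<^sup>2 - 1)"
    using assms by (simp add: power2_eq_square)
qed

section \<open>The Askey-Wilson relations from abstract data\<close>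

text \<open>Here \<open>Y = X\<inverse>\<close>, and the products \<open>P M = F(Y)\<close> and \<open>M P = F(q\<^sup>-\<^sup>2 Y)\<close> come from one polynomial \<open>F\<close>
  with coefficients in the parameters \<open>\<beta>\<close>, \<open>\<beta>'\<close>, \<open>\<delta>\<close>.\<close>

locale askey_wilson_data = complex_algebra +
  fixes q a c :: complex and X Y P M \<beta> \<beta>' \<delta> N
  assumes closed [simp]: "X \<in> carrier A" "Y \<in> carrier A" "P \<in> carrier A" "M \<in> carrier A"
      "\<beta> \<in> carrier A" "\<beta>' \<in> carrier A" "\<delta> \<in> carrier A"
    and q_nz: "q \<noteq> 0" "q\<^sup>2 \<noteq> 1"
    and a_eq: "a = q / (q\<^sup>2 - 1)\<^sup>2" and c_eq: "c = (q\<^sup>2 + 1) / (q\<^sup>2 - 1)\<^sup>2"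
    and XY: "X \<otimes> Y = \<one>" and YX: "Y \<otimes> X = \<one>"
    and PX: "P \<otimes> X = inverse (q\<^sup>2) \<odot> (X \<otimes> P)" and PY: "P \<otimes> Y = q\<^sup>2 \<odot> (Y \<otimes> P)"
    and MX: "M \<otimes> X = q\<^sup>2 \<odot> (X \<otimes> M)" and MY: "M \<otimes> Y = inverse (q\<^sup>2) \<odot> (Y \<otimes> M)"
    and central: "X \<otimes> \<beta> = \<beta> \<otimes> X" "Y \<otimes> \<beta> = \<beta> \<otimes> Y" "P \<otimes> \<beta> = \<beta> \<otimes> P" "M \<otimes> \<beta> = \<beta> \<otimes> M"
      "X \<otimes> \<beta>' = \<beta>' \<otimes> X" "X \<otimes> \<delta> = \<delta> \<otimes> X"
    and PM: "P \<otimes> M = q\<^sup>2 \<odot> (\<delta> \<otimes> (Y \<otimes> Y)) \<oplus> (a * q) \<odot> (\<beta>' \<otimes> Y)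
       \<oplus> (a * q ^ 3) \<odot> (\<beta> \<otimes> (Y \<otimes> (Y \<otimes> Y))) \<oplus> (a\<^sup>2 * q ^ 4) \<odot> (Y \<otimes> (Y \<otimes> (Y \<otimes> Y))) \<oplus> a\<^sup>2 \<odot> \<one>"
    and MP: "M \<otimes> P = inverse (q\<^sup>2) \<odot> (\<delta> \<otimes> (Y \<otimes> Y)) \<oplus> (a / q) \<odot> (\<beta>' \<otimes> Y)
       \<oplus> (a / q ^ 3) \<odot> (\<beta> \<otimes> (Y \<otimes> (Y \<otimes> Y))) \<oplus> (a\<^sup>2 / q ^ 4) \<odot> (Y \<otimes> (Y \<otimes> (Y \<otimes> Y))) \<oplus> a\<^sup>2 \<odot> \<one>"
    and N_eq: "N = c \<odot> \<one> \<oplus> 1 \<odot> (\<beta> \<otimes> Y) \<oplus> c \<odot> (Y \<otimes> Y) \<oplus> 1 \<odot> P \<oplus> 1 \<odot> M"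
begin

lemma cancel_inverse:
  "w \<in> carrier A \<Longrightarrow> X \<otimes> (Y \<otimes> w) = w" "w \<in> carrier A \<Longrightarrow> Y \<otimes> (X \<otimes> w) = w"
  using XY YX by (metis m_assoc closed l_one)+

text \<open>Normal order: parameters first, then powers of \<open>X\<close> or \<open>Y\<close>,
  then \<open>P\<close> and \<open>M\<close>.\<close>

lemmas normal_simps = expand_simps PX PY MX MY central
  PX[THEN left_commute_smult] PY[THEN left_commute_smult] MX[THEN left_commute_smult] MY[THEN left_commute_smult]
  central[THEN left_commute_eq] XY YX cancel_inverse

lemma N_closed [simp]: "N \<in> carrier A" by (simp add: N_eq)

text \<open>On a summand Z of \<open>N\<close> with Z X = t X Z, the expression X X Z - (q^2 + q^-2)
  X Z X + Z X X equals (t - q^2)(t - q^-2) X X Z. This vanishes for \<open>P\<close> and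
  \<open>M\<close>; the other summands have t = 1 and the factor becomes -(q - q^-1)^2.\<close>

lemma XXN_relation:
  "X \<otimes> (X \<otimes> N) \<oplus> N \<otimes> (X \<otimes> X) = (q\<^sup>2 + inverse (q\<^sup>2)) \<odot> (X \<otimes> (N \<otimes> X))
     \<oplus> (- (q - inverse q)\<^sup>2) \<odot> (c \<odot> (X \<otimes> X) \<oplus> 1 \<odot> (\<beta> \<otimes> X) \<oplus> c \<odot> \<one>)"
proof -
  define ms where "ms = [\<one>, \<beta> \<otimes> X, X \<otimes> X, X \<otimes> (X \<otimes> P), X \<otimes> (X \<otimes> M)]"
  have ms: "set ms \<subseteq> carrier A" by (simp add: ms_def)
  have basis: "k \<odot> \<one> = lincomb [k,0,0,0,0] ms" "k \<odot> (\<beta> \<otimes> X) = lincomb [0,k,0,0,0] ms"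
    "k \<odot> (X \<otimes> X) = lincomb [0,0,k,0,0] ms" "k \<odot> (X \<otimes> (X \<otimes> P)) = lincomb [0,0,0,k,0] ms"
    "k \<odot> (X \<otimes> (X \<otimes> M)) = lincomb [0,0,0,0,k] ms" for k by (simp_all add: ms_def)
  show ?thesis
    apply (simp add: normal_simps N_eq del: smult_one)
    apply (simp add: basis lincomb_add lincomb_smult ms del: smult_one)
    apply (rule lincomb_cong)
    using q_nz by (simp add: field_simps eval_nat_numeral)
qed

lemmas scalar_relations = casimir_scalars[OF q_nz a_eq c_eq]

text \<open>Let \<open>P\<close> have degree 1 and \<open>M\<close> degree -1. Degrees 2 and -2
  cancel as in \<open>XXN_relation\<close>. In degrees 1 and -1 the constant of \<open>N\<close>
  gives the anticommutator, because c (q - q^-1)^2 = 1 + q^-2. In degree 0 the \<delta> terms of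
  \<open>PM\<close> and \<open>MP\<close> cancel, and the \<beta>' terms leave -(1 + q^-2)
  \<beta>'.\<close>

lemma XNN_relation:
  "X \<otimes> (N \<otimes> N) \<oplus> N \<otimes> (N \<otimes> X) = (q\<^sup>2 + inverse (q\<^sup>2)) \<odot> (N \<otimes> (X \<otimes> N))
     \<oplus> (- (1 + inverse (q\<^sup>2))) \<odot> (X \<otimes> N \<oplus> N \<otimes> X) \<oplus> (- (q - inverse q)\<^sup>2) \<odot> (\<beta> \<otimes> N)
     \<oplus> (1 + inverse (q\<^sup>2)) \<odot> (1 \<odot> \<beta> \<oplus> (- 1) \<odot> \<beta>')"
proof -
  define ms where "ms = [X, Y, Y \<otimes> (Y \<otimes> Y), \<beta>, \<beta>', \<beta> \<otimes> (\<beta> \<otimes> Y), \<beta> \<otimes> (Y \<otimes> Y), \<delta> \<otimes> Y,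
    X \<otimes> P, Y \<otimes> P, \<beta> \<otimes> P, X \<otimes> M, Y \<otimes> M, \<beta> \<otimes> M, X \<otimes> (P \<otimes> P), X \<otimes> (M \<otimes> M)]"
  have ms: "set ms \<subseteq> carrier A" by (simp add: ms_def)
  have basis: "k \<odot> X = lincomb [k,0,0,0,0,0,0,0,0,0,0,0,0,0,0,0] ms"
    "k \<odot> Y = lincomb [0,k,0,0,0,0,0,0,0,0,0,0,0,0,0,0] ms"
    "k \<odot> (Y \<otimes> (Y \<otimes> Y)) = lincomb [0,0,k,0,0,0,0,0,0,0,0,0,0,0,0,0] ms"
    "k \<odot> \<beta> = lincomb [0,0,0,k,0,0,0,0,0,0,0,0,0,0,0,0] ms"
    "k \<odot> \<beta>' = lincomb [0,0,0,0,k,0,0,0,0,0,0,0,0,0,0,0] ms"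
    "k \<odot> (\<beta> \<otimes> (\<beta> \<otimes> Y)) = lincomb [0,0,0,0,0,k,0,0,0,0,0,0,0,0,0,0] ms"
    "k \<odot> (\<beta> \<otimes> (Y \<otimes> Y)) = lincomb [0,0,0,0,0,0,k,0,0,0,0,0,0,0,0,0] ms"
    "k \<odot> (\<delta> \<otimes> Y) = lincomb [0,0,0,0,0,0,0,k,0,0,0,0,0,0,0,0] ms"
    "k \<odot> (X \<otimes> P) = lincomb [0,0,0,0,0,0,0,0,k,0,0,0,0,0,0,0] ms"
    "k \<odot> (Y \<otimes> P) = lincomb [0,0,0,0,0,0,0,0,0,k,0,0,0,0,0,0] ms"
    "k \<odot> (\<beta> \<otimes> P) = lincomb [0,0,0,0,0,0,0,0,0,0,k,0,0,0,0,0] ms"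
    "k \<odot> (X \<otimes> M) = lincomb [0,0,0,0,0,0,0,0,0,0,0,k,0,0,0,0] ms"
    "k \<odot> (Y \<otimes> M) = lincomb [0,0,0,0,0,0,0,0,0,0,0,0,k,0,0,0] ms"
    "k \<odot> (\<beta> \<otimes> M) = lincomb [0,0,0,0,0,0,0,0,0,0,0,0,0,k,0,0] ms"
    "k \<odot> (X \<otimes> (P \<otimes> P)) = lincomb [0,0,0,0,0,0,0,0,0,0,0,0,0,0,k,0] ms"
    "k \<odot> (X \<otimes> (M \<otimes> M)) = lincomb [0,0,0,0,0,0,0,0,0,0,0,0,0,0,0,k] ms" for k
    by (simp_all add: ms_def)
  \<comment> \<open>With the inverse named, the coefficient equations are polynomial and follow from
    \<open>rel\<close>, which includes q i = 1.\<close>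
  define i where "i = inverse q"
  have i: "inverse (q ^ n) = i ^ n" "x / q ^ n = x * i ^ n" "x / q = x * i" "inverse q = i" for n x
    by (simp_all add: i_def divide_inverse power_inverse)
  note rel = scalar_relations(1-3)[unfolded i]
  show ?thesis
    apply (simp add: normal_simps N_eq PM MP del: smult_one)
    apply (simp add: basis lincomb_add lincomb_smult ms del: smult_one)
    apply (rule lincomb_cong)
    apply (simp, unfold i, intro conjI)
    using rel by Groebner_Basis.algebra+
qed

definition K1 where "K1 = (1 / 4) \<odot> ((1 / (1 - q)) \<odot> (\<one> \<ominus> X))"
definition K2 where "K2 = (1 / 2) \<odot> N"
text \<open>The form in which the element arises from \<open>XXN_relation\<close>;
  \<open>\<xi>\<^sub>7_tensor_form\<close> expresses it through the Casimir elements and the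
  q-bracket.\<close>

definition \<xi>\<^sub>7 where "\<xi>\<^sub>7 = ((1 + q)\<^sup>2 / (32 * q\<^sup>2)) \<odot> (\<beta> \<oplus> (2 * c) \<odot> \<one>)"

lemma K_closed: "K1 \<in> carrier A" "K2 \<in> carrier A"
  by (simp_all add: K1_def K2_def)

text \<open>The summands of \<open>N\<close> other than \<open>P\<close> and \<open>M\<close>
  commute with \<open>X\<close>. For the rest, [P,X] = (1 - q^2) P X and [M,X] = (1 - q^-2) M X, and
  division by 1 - q leaves 1 + q and -q^-2 (1 + q).\<close>

lemma commutator_K1_K2:
  "commutator A K1 K2 = (1 / 8 * (1 + q)) \<odot> (P \<otimes> X \<ominus> inverse (q\<^sup>2) \<odot> (M \<otimes> X))"
proof -
  define u where "u = 1 / (1 - q)"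
  have "1 - q \<noteq> 0" using q_nz by auto
  then have u: "u * (1 - q) = 1" by (simp add: u_def)
  define ms where "ms = [N, X \<otimes> N, N \<otimes> X]"
  have ms: "set ms \<subseteq> carrier A" by (simp add: ms_def)
  have basis: "k \<odot> N = lincomb [k,0,0] ms" "k \<odot> (X \<otimes> N) = lincomb [0,k,0] ms"
    "k \<odot> (N \<otimes> X) = lincomb [0,0,k] ms" for k by (simp_all add: ms_def)
  have "commutator A K1 K2 = (u / 8) \<odot> (N \<otimes> X \<oplus> (- 1) \<odot> (X \<otimes> N))"
    by (simp add: commutator_def K1_def[folded u_def] K2_def expand_simps del: smult_one)
      (simp add: basis lincomb_add lincomb_smult ms del: smult_one)
  also have "\<dots> = (1 / 8 * (1 + q)) \<odot> (P \<otimes> X \<ominus> inverse (q\<^sup>2) \<odot> (M \<otimes> X))"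
  proof -
    define ms where "ms = [Y, X, \<beta>, X \<otimes> P, X \<otimes> M]"
    have ms: "set ms \<subseteq> carrier A" by (simp add: ms_def)
    have basis: "k \<odot> Y = lincomb [k,0,0,0,0] ms" "k \<odot> X = lincomb [0,k,0,0,0] ms"
      "k \<odot> \<beta> = lincomb [0,0,k,0,0] ms" "k \<odot> (X \<otimes> P) = lincomb [0,0,0,k,0] ms"
      "k \<odot> (X \<otimes> M) = lincomb [0,0,0,0,k] ms" for k by (simp_all add: ms_def)
    define i where "i = inverse q"
    have i: "inverse (q ^ n) = i ^ n" for n by (simp add: i_def power_inverse)
    have "q * i = 1" using q_nz by (simp add: i_def)
    then show ?thesis
      apply (simp add: normal_simps N_eq i del: smult_one)
      apply (simp add: basis lincomb_add lincomb_smult ms del: smult_one)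
      apply (rule lincomb_cong)
      apply simp
      using u by (intro conjI; Groebner_Basis.algebra)
  qed
  finally show ?thesis .
qed

text \<open>The unit in \<open>K1\<close> drops out of the commutator, so the left side is a
  multiple of X N N - 2 N X N + N N X and reduces by \<open>XNN_relation\<close>. The factor 1/(q -
  q^-1) in the last term is the denominator of the q-bracket in \<xi>5.\<close>

lemma askey_wilson_K2_K3:
  "commutator A K2 (commutator A K1 K2) =
     (- (q - inverse q)\<^sup>2) \<odot> (K2 \<otimes> K1 \<otimes> K2) \<oplus> ((1 + inverse (q\<^sup>2)) / 2) \<odot> anticommutator A K1 K2
     \<oplus> ((1 + q)\<^sup>2 * (1 - q) / (4 * q\<^sup>2)) \<odot> (K2 [^] (2::nat))
     \<oplus> ((4 * (q - 1)) \<odot> \<xi>\<^sub>7) \<otimes> K2 \<oplus> 0 \<odot> K1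
     \<oplus> (- ((1 + q) * (1 + q\<^sup>2) / (16 * q ^ 3 * (q - inverse q)))) \<odot> (\<beta> \<ominus> \<beta>')"
proof -
  define ms where "ms = [X \<otimes> (N \<otimes> N), N \<otimes> (X \<otimes> N), N \<otimes> N, X \<otimes> N, N \<otimes> X, N, \<beta> \<otimes> N, \<beta>, \<beta>']"
  have ms: "set ms \<subseteq> carrier A" by (simp add: ms_def)
  have basis: "k \<odot> (X \<otimes> (N \<otimes> N)) = lincomb [k,0,0,0,0,0,0,0,0] ms"
    "k \<odot> (N \<otimes> (X \<otimes> N)) = lincomb [0,k,0,0,0,0,0,0,0] ms"
    "k \<odot> (N \<otimes> N) = lincomb [0,0,k,0,0,0,0,0,0] ms"
    "k \<odot> (X \<otimes> N) = lincomb [0,0,0,k,0,0,0,0,0] ms"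
    "k \<odot> (N \<otimes> X) = lincomb [0,0,0,0,k,0,0,0,0] ms"
    "k \<odot> N = lincomb [0,0,0,0,0,k,0,0,0] ms"
    "k \<odot> (\<beta> \<otimes> N) = lincomb [0,0,0,0,0,0,k,0,0] ms"
    "k \<odot> \<beta> = lincomb [0,0,0,0,0,0,0,k,0] ms"
    "k \<odot> \<beta>' = lincomb [0,0,0,0,0,0,0,0,k] ms" for k by (simp_all add: ms_def)
  \<comment> \<open>Only \<open>N \<otimes> (N \<otimes> X)\<close> is eliminated; the other two
    cubic words stay as basis monomials.\<close>
  note NNX = add_eq_imp_eq[OF XNN_relation]
  define u where "u = 1 / (1 - q)"
  have "1 - q \<noteq> 0" "q - inverse q \<noteq> 0" using q_nz by (auto simp: field_simps power2_eq_square)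
  define i where "i = inverse q"
  define v where "v = 1 / (q - i)"
  have "u * (1 - q) = 1" "v * (q - i) = 1"
    using \<open>1 - q \<noteq> 0\<close> \<open>q - inverse q \<noteq> 0\<close> by (simp_all add: u_def v_def i_def)
  note rel = this scalar_relations(1-3)[folded i_def]
  have i: "inverse (q ^ n) = i ^ n" "x / (k * q ^ n) = x * i ^ n / k" "inverse q = i"
    "x / (k * q ^ n * (q - i)) = x * i ^ n * v / k" for n x k
    by (simp_all add: i_def v_def divide_inverse power_inverse)
  show ?thesis
    apply (simp add: commutator_def anticommutator_def square_eq K_closed)
    apply (simp add: K1_def[folded u_def] K2_def \<xi>\<^sub>7_def NNX expand_simps i del: smult_one)
    apply (simp add: basis lincomb_add lincomb_smult ms del: smult_one)
    apply (rule lincomb_cong)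
    apply (simp, intro conjI)
    using rel by ((simp add: algebra_simps; fail) | Groebner_Basis.algebra)+
qed

text \<open>Again only \<open>X\<close> contributes to the commutators, and
  \<open>XXN_relation\<close> eliminates \<open>N \<otimes> (X \<otimes> X)\<close>. The terms of
  lower order come from expanding 1 - X in the products on the right.\<close>

lemma askey_wilson_K3_K1:
  "commutator A (commutator A K1 K2) K1 =
     (- (q - inverse q)\<^sup>2) \<odot> (K1 \<otimes> K2 \<otimes> K1) \<oplus> ((1 + inverse (q\<^sup>2)) / 2) \<odot> (K1 [^] (2::nat))
     \<oplus> ((1 + q)\<^sup>2 * (1 - q) / (4 * q\<^sup>2)) \<odot> anticommutator A K1 K2
     \<oplus> ((4 * (q - 1)) \<odot> \<xi>\<^sub>7) \<otimes> K1 \<oplus> (- ((1 + q)\<^sup>2 / (16 * q\<^sup>2))) \<odot> K2 \<oplus> \<xi>\<^sub>7"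
proof -
  define ms where "ms = [X \<otimes> (X \<otimes> N), X \<otimes> (N \<otimes> X), X \<otimes> N, N \<otimes> X, N, \<one>, X, X \<otimes> X, \<beta> \<otimes> X, \<beta>]"
  have ms: "set ms \<subseteq> carrier A" by (simp add: ms_def)
  have basis: "k \<odot> (X \<otimes> (X \<otimes> N)) = lincomb [k,0,0,0,0,0,0,0,0,0] ms"
    "k \<odot> (X \<otimes> (N \<otimes> X)) = lincomb [0,k,0,0,0,0,0,0,0,0] ms"
    "k \<odot> (X \<otimes> N) = lincomb [0,0,k,0,0,0,0,0,0,0] ms"
    "k \<odot> (N \<otimes> X) = lincomb [0,0,0,k,0,0,0,0,0,0] ms"
    "k \<odot> N = lincomb [0,0,0,0,k,0,0,0,0,0] ms"
    "k \<odot> \<one> = lincomb [0,0,0,0,0,k,0,0,0,0] ms"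
    "k \<odot> X = lincomb [0,0,0,0,0,0,k,0,0,0] ms"
    "k \<odot> (X \<otimes> X) = lincomb [0,0,0,0,0,0,0,k,0,0] ms"
    "k \<odot> (\<beta> \<otimes> X) = lincomb [0,0,0,0,0,0,0,0,k,0] ms"
    "k \<odot> \<beta> = lincomb [0,0,0,0,0,0,0,0,0,k] ms" for k by (simp_all add: ms_def)
  note NXX = add_eq_imp_eq[OF XXN_relation]
  define u where "u = 1 / (1 - q)"
  have "1 - q \<noteq> 0" using q_nz by auto
  then have "u * (1 - q) = 1" by (simp add: u_def)
  define i where "i = inverse q"
  note rel = \<open>u * (1 - q) = 1\<close> scalar_relations(1-3)[folded i_def]
  have i: "inverse (q ^ n) = i ^ n" "x / (k * q ^ n) = x * i ^ n / k" "inverse q = i" for n x k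
    by (simp_all add: i_def divide_inverse power_inverse)
  show ?thesis
    apply (simp add: commutator_def anticommutator_def square_eq K_closed)
    apply (simp add: K1_def[folded u_def] K2_def \<xi>\<^sub>7_def NXX expand_simps i del: smult_one)
    apply (simp add: basis lincomb_add lincomb_smult ms del: smult_one)
    apply (rule lincomb_cong)
    apply (simp, intro conjI)
    using rel by ((simp add: algebra_simps; fail) | Groebner_Basis.algebra)+
qed

lemma commutes_K:
  assumes z: "z \<in> carrier A" "z \<otimes> X = X \<otimes> z" "z \<otimes> N = N \<otimes> z"
  shows "z \<otimes> K1 = K1 \<otimes> z" "z \<otimes> K2 = K2 \<otimes> z" "z \<otimes> commutator A K1 K2 = commutator A K1 K2 \<otimes> z"
proof -
  show 1: "z \<otimes> K1 = K1 \<otimes> z" and 2: "z \<otimes> K2 = K2 \<otimes> z"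
    using z by (simp_all add: K1_def K2_def expand_simps)
  note c = z(1) K_closed
  have "z \<otimes> (K1 \<otimes> K2) = K1 \<otimes> K2 \<otimes> z" "z \<otimes> (K2 \<otimes> K1) = K2 \<otimes> K1 \<otimes> z"
    using c 1 2 by (metis m_assoc)+
  then show "z \<otimes> commutator A K1 K2 = commutator A K1 K2 \<otimes> z"
    using c by (simp add: commutator_def diff_eq_smult r_distr l_distr smult_mult_l smult_mult_r)
qed

end

section \<open>Images of the quantum algebra and centrality of the Casimir element\<close>

text \<open>Taking an arbitrary family as argument lets one formula cover C (x) 1, 1 (x) C and
  Delta(C).\<close>

definition uq_casimir :: "complex \<Rightarrow> (complex, 'a) module \<Rightarrow> (uq_gen \<Rightarrow> 'a) \<Rightarrow> 'a" where
  "uq_casimir h A f = (let q = exp h; E = (\<lambda>l. f (Gen_exp l)) in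
     (f Gen_plus \<otimes>\<^bsub>A\<^esub> f Gen_minus \<otimes>\<^bsub>A\<^esub> (q \<odot>\<^bsub>A\<^esub> E (- 2))
       \<ominus>\<^bsub>A\<^esub> (q / (q\<^sup>2 - 1)\<^sup>2) \<odot>\<^bsub>A\<^esub> (inverse q \<odot>\<^bsub>A\<^esub> E 2 \<oplus>\<^bsub>A\<^esub> q \<odot>\<^bsub>A\<^esub> E (- 2)))
       \<oplus>\<^bsub>A\<^esub> ((q\<^sup>2 + 1) / (q\<^sup>2 - 1)\<^sup>2) \<odot>\<^bsub>A\<^esub> \<one>\<^bsub>A\<^esub>)"

text \<open>Only the relations of the family are used, so the computations apply to either tensor
  factor inside \<open>Uq2 h\<close>.\<close>

locale uq_image = complex_algebra +
  fixes h q :: complex and f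
  assumes family: "uq_family h A f" and log_q: "exp h = q" and q2: "q\<^sup>2 \<noteq> 1"
begin

abbreviation "x \<equiv> f Gen_zero"
abbreviation "p \<equiv> f Gen_plus"
abbreviation "m \<equiv> f Gen_minus"
abbreviation "E l \<equiv> f (Gen_exp l)"

definition a where "a = q / (q\<^sup>2 - 1)\<^sup>2"
definition c where "c = (q\<^sup>2 + 1) / (q\<^sup>2 - 1)\<^sup>2"

lemma q_nz [simp]: "q \<noteq> 0" using log_q by auto

lemma gen_closed [simp]: "f s \<in> carrier A"
  using family by (auto simp: uq_family_def)

lemma E_0: "E 0 = \<one>" and E_E: "E l \<otimes> E k = E (l + k)"
  using family by (auto simp: uq_family_def)

lemma E_E_left: "w \<in> carrier A \<Longrightarrow> E l \<otimes> (E k \<otimes> w) = E (l + k) \<otimes> w"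
  by (simp add: E_E[symmetric] m_assoc)

text \<open>At integer exponents the logarithm disappears and the scalars are powers of
  \<open>q\<close>.\<close>

lemma exp_int: "exp (h * of_int n) = q powi n"
proof -
  have "exp (h * of_nat k) = q ^ k" for k
    by (simp add: exp_of_nat2_mult log_q)
  then show ?thesis
    by (cases n rule: int_cases2) (simp_all add: power_int_minus exp_minus)
qed

lemma E_p_int: "E (of_int n) \<otimes> p = (q powi n) \<odot> (p \<otimes> E (of_int n))"
  using family by (auto simp: uq_family_def simp flip: exp_int)

lemma E_m_int: "E (of_int n) \<otimes> m = (q powi - n) \<odot> (m \<otimes> E (of_int n))"
  using family by (auto simp: uq_family_def simp flip: exp_int)

lemma powi_minus: "q powi - 2 = inverse (q\<^sup>2)" "q powi - 4 = inverse (q ^ 4)"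
  by (simp_all add: power_int_minus)

text \<open>Instances with numerals, since rewriting does not match a numeral against
  \<open>of_int n\<close>.\<close>

lemmas E_p = E_p_int[of 1, simplified] E_p_int[of "-1", simplified] E_p_int[of 2, simplified]
  E_p_int[of "-2", simplified, unfolded powi_minus]
  E_p_int[of 4, simplified]
lemmas E_m = E_m_int[of 1, simplified] E_m_int[of "-1", simplified] E_m_int[of 2, simplified, unfolded powi_minus]
  E_m_int[of "-2", simplified]
  E_m_int[of 4, simplified, unfolded powi_minus]

lemma x_p: "x \<otimes> p = p \<otimes> x \<oplus> 1 \<odot> p" and x_m: "x \<otimes> m = m \<otimes> x \<oplus> (- 1) \<odot> m"
  and x_E: "x \<otimes> E l = E l \<otimes> x"
  using family by (auto simp: uq_family_def commutator_def minus_eq_zero_iff minus_eq_smult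
      intro!: minus_eq_imp_eq)

lemmas scalar_relations = casimir_scalars[OF q_nz q2 a_def c_def]

text \<open>Here q^(2 J0) [2 J0]_q collapses to (q^(4 J0) - 1)/(q - q^-1), and the scalar is q/(q^2
  - 1) = a (q^2 - 1).\<close>

lemma m_p: "m \<otimes> p = q\<^sup>2 \<odot> (p \<otimes> m) \<oplus> (a * (q\<^sup>2 - 1)) \<odot> (E 4 \<oplus> (- 1) \<odot> \<one>)"
proof -
  have "q - inverse q = (q\<^sup>2 - 1) / q"
    using q_nz by (simp add: field_simps power2_eq_square)
  then have "m \<otimes> p = q\<^sup>2 \<odot> (p \<otimes> m) \<oplus> E 2 \<otimes> ((q / (q\<^sup>2 - 1)) \<odot> (E 2 \<oplus> (- 1) \<odot> E (- 2)))"
    using family by (intro minus_eq_imp_eq) (simp_all add: uq_family_def log_q q_bracket_def diff_eq_smult)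
  then show ?thesis by (simp add: expand_simps E_E E_0 scalar_relations(4))
qed

text \<open>The Casimir element without its constant \<open>c\<close>; products of \<open>p\<close>
  and \<open>m\<close> are shorter in terms of it.\<close>

definition G where "G = q \<odot> (p \<otimes> (m \<otimes> E (- 2))) \<oplus> (- (a / q)) \<odot> E 2 \<oplus> (- (a * q)) \<odot> E (- 2)"

lemma G_closed [simp]: "G \<in> carrier A" by (simp add: G_def)

lemma casimir_eq: "uq_casimir h A f = G \<oplus> c \<odot> \<one>"
  by (simp add: uq_casimir_def Let_def log_q G_def expand_simps a_def c_def divide_inverse a_assoc)

text \<open>Together with \<open>pbw_simps\<close>, rewriting into Poincare-Birkhoff-Witt order:
  \<open>p\<close>, \<open>m\<close>, exponentials, \<open>x\<close>.\<close>

lemmas left_rules = E_p[THEN left_commute_smult] E_m[THEN left_commute_smult]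
  m_p[THEN left_mult_eq] x_p[THEN left_mult_eq] x_m[THEN left_mult_eq] x_E[THEN left_commute_eq]
lemmas pbw_simps = expand_simps E_0 E_E E_E_left E_p E_m x_p x_m x_E m_p left_rules

text \<open>The definition of \<open>G\<close> solved for its leading term.\<close>

lemma p_m_G: "p \<otimes> m = inverse q \<odot> (G \<otimes> E 2) \<oplus> (a * inverse (q\<^sup>2)) \<odot> E 4 \<oplus> a \<odot> \<one>"
proof -
  define ms where "ms = [p \<otimes> m, E 4, \<one>]"
  have ms: "set ms \<subseteq> carrier A" by (simp add: ms_def)
  have basis: "k \<odot> (p \<otimes> m) = lincomb [k,0,0] ms" "k \<odot> E 4 = lincomb [0,k,0] ms"
    "k \<odot> \<one> = lincomb [0,0,k] ms" for k by (simp_all add: ms_def)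
  have "1 \<odot> (p \<otimes> m) = inverse q \<odot> (G \<otimes> E 2) \<oplus> (a * inverse (q\<^sup>2)) \<odot> E 4 \<oplus> a \<odot> \<one>"
    apply (simp add: G_def pbw_simps del: smult_one)
    apply (simp add: basis lincomb_add lincomb_smult ms del: smult_one)
    by (rule lincomb_cong) (simp add: field_simps power2_eq_square)
  then show ?thesis by simp
qed

text \<open>The polynomial of \<open>p_m_G\<close> with J0 shifted by one, that is, with q^(2 J0)
  multiplied by q^2.\<close>

lemma m_p_G: "m \<otimes> p = q \<odot> (G \<otimes> E 2) \<oplus> (a * q\<^sup>2) \<odot> E 4 \<oplus> a \<odot> \<one>"
proof -
  define ms where "ms = [G \<otimes> E 2, E 4, \<one>]"
  have ms: "set ms \<subseteq> carrier A" by (simp add: ms_def)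
  have basis: "k \<odot> (G \<otimes> E 2) = lincomb [k,0,0] ms" "k \<odot> E 4 = lincomb [0,k,0] ms"
    "k \<odot> \<one> = lincomb [0,0,k] ms" for k by (simp_all add: ms_def)
  show ?thesis unfolding m_p p_m_G
    apply (simp add: expand_simps del: smult_one)
    apply (simp add: basis lincomb_add lincomb_smult ms del: smult_one)
    by (rule lincomb_cong) (simp add: field_simps power2_eq_square)
qed

text \<open>The factors picked up from \<open>p\<close> and \<open>m\<close> are inverse to each
  other.\<close>

lemma E_G: "E l \<otimes> G = G \<otimes> E l"
proof -
  have p: "E l \<otimes> p = exp (h * l) \<odot> (p \<otimes> E l)" and m: "E l \<otimes> m = exp (h * - l) \<odot> (m \<otimes> E l)"
    using family by (auto simp: uq_family_def)
  have "exp (h * l) * exp (h * - l) = 1" by (simp flip: exp_add)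
  moreover have "E l \<otimes> (p \<otimes> (m \<otimes> E (- 2))) = (exp (h * l) * exp (h * - l)) \<odot> (p \<otimes> (m \<otimes> E (- 2) \<otimes> E l))"
    by (simp add: expand_simps E_E E_E_left p m p[THEN left_commute_smult] m[THEN left_commute_smult] ac_simps)
  ultimately show ?thesis
    by (simp add: G_def expand_simps E_E ac_simps)
qed

text \<open>The shifts 1 and -1 from \<open>p\<close> and \<open>m\<close> cancel.\<close>

lemma x_G: "x \<otimes> G = G \<otimes> x"
proof -
  have "x \<otimes> (p \<otimes> (m \<otimes> E (- 2))) = p \<otimes> (m \<otimes> (E (- 2) \<otimes> x))"
  proof -
    define ms where "ms = [p \<otimes> (m \<otimes> (E (- 2) \<otimes> x)), p \<otimes> (m \<otimes> E (- 2))]"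
    have ms: "set ms \<subseteq> carrier A" by (simp add: ms_def)
    have basis: "k \<odot> (p \<otimes> (m \<otimes> (E (- 2) \<otimes> x))) = lincomb [k,0] ms"
      "k \<odot> (p \<otimes> (m \<otimes> E (- 2))) = lincomb [0,k] ms" for k by (simp_all add: ms_def)
    have "1 \<odot> (x \<otimes> (p \<otimes> (m \<otimes> E (- 2)))) = 1 \<odot> (p \<otimes> (m \<otimes> (E (- 2) \<otimes> x)))"
      by (simp add: expand_simps x_p x_m x_E left_rules del: smult_one)
        (simp add: basis lincomb_add lincomb_smult ms del: smult_one)
    then show ?thesis by simp
  qed
  then show ?thesis by (simp add: G_def expand_simps x_E)
qed

text \<open>Reordering \<open>m\<close> and \<open>p\<close> by \<open>m_p\<close> produces terms in
  \<open>E 2\<close> and \<open>E (- 2)\<close>; they offset the q-factors that the two exponential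
  summands of \<open>G\<close> pick up.\<close>

lemma p_G: "p \<otimes> G = G \<otimes> p" and m_G: "m \<otimes> G = G \<otimes> m"
proof -
  define i where "i = inverse q"
  have i: "inverse (q ^ n) = i ^ n" "y / q = y * i" "inverse q = i" for n y
    by (simp_all add: i_def divide_inverse power_inverse)
  note rel = scalar_relations(1-3)[unfolded i]
  show "p \<otimes> G = G \<otimes> p"
  proof -
    define ms where "ms = [p \<otimes> (p \<otimes> (m \<otimes> E (- 2))), p \<otimes> E 2, p \<otimes> E (- 2)]"
    have ms: "set ms \<subseteq> carrier A" by (simp add: ms_def)
    have basis: "k \<odot> (p \<otimes> (p \<otimes> (m \<otimes> E (- 2)))) = lincomb [k,0,0] ms"
      "k \<odot> (p \<otimes> E 2) = lincomb [0,k,0] ms" "k \<odot> (p \<otimes> E (- 2)) = lincomb [0,0,k] ms" for k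
      by (simp_all add: ms_def)
    show ?thesis
      apply (simp add: G_def pbw_simps del: smult_one)
      apply (simp add: basis lincomb_add lincomb_smult ms i del: smult_one)
      apply (rule lincomb_cong)
      apply (simp, intro conjI)
      using rel by ((simp add: algebra_simps; fail) | Groebner_Basis.algebra)+
  qed
  show "m \<otimes> G = G \<otimes> m"
  proof -
    define ms where "ms = [p \<otimes> (m \<otimes> (m \<otimes> E (- 2))), m \<otimes> E 2, m \<otimes> E (- 2)]"
    have ms: "set ms \<subseteq> carrier A" by (simp add: ms_def)
    have basis: "k \<odot> (p \<otimes> (m \<otimes> (m \<otimes> E (- 2)))) = lincomb [k,0,0] ms"
      "k \<odot> (m \<otimes> E 2) = lincomb [0,k,0] ms" "k \<odot> (m \<otimes> E (- 2)) = lincomb [0,0,k] ms" for k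
      by (simp_all add: ms_def)
    show ?thesis
      apply (simp add: G_def pbw_simps del: smult_one)
      apply (simp add: basis lincomb_add lincomb_smult ms i del: smult_one)
      apply (rule lincomb_cong)
      apply (simp, intro conjI)
      using rel by ((simp add: algebra_simps; fail) | Groebner_Basis.algebra)+
  qed
qed

end

section \<open>Two commuting images and the coproduct of the Casimir element\<close>

text \<open>The families \<open>f\<close> and \<open>g\<close> stand for \<open>s \<mapsto> s \<otimes> 1\<close> and \<open>s \<mapsto> 1 \<otimes> s\<close>, so that \<open>u \<otimes> v\<close> becomes a product.\<close>

locale uq_pair = complex_algebra + F: uq_image A h q f + F': uq_image A h q g for h q f g +
  assumes commute: "g t \<otimes> f s = f s \<otimes> g t"
begin

abbreviation "a \<equiv> F.a"
abbreviation "c \<equiv> F.c"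
abbreviation "p \<equiv> f Gen_plus"
abbreviation "m \<equiv> f Gen_minus"
abbreviation "E l \<equiv> f (Gen_exp l)"
abbreviation "G \<equiv> F.G"
abbreviation "p' \<equiv> g Gen_plus"
abbreviation "m' \<equiv> g Gen_minus"
abbreviation "E' l \<equiv> g (Gen_exp l)"
abbreviation "G' \<equiv> F'.G"

lemma G_central: "g t \<otimes> G = G \<otimes> g t" "f s \<otimes> G' = G' \<otimes> f s"
    "f s \<otimes> G = G \<otimes> f s" "g t \<otimes> G' = G' \<otimes> g t"
proof -
  show "g t \<otimes> G = G \<otimes> g t"
    by (simp add: F.G_def expand_simps commute commute[THEN left_commute_eq])
  show "f s \<otimes> G' = G' \<otimes> f s"
    by (simp add: F'.G_def expand_simps commute[symmetric] commute[symmetric, THEN left_commute_eq])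
  show "f s \<otimes> G = G \<otimes> f s" by (cases s) (simp_all add: F.x_G F.p_G F.m_G F.E_G)
  show "g t \<otimes> G' = G' \<otimes> g t" by (cases t) (simp_all add: F'.x_G F'.p_G F'.m_G F'.E_G)
qed

lemma G'_G: "G' \<otimes> G = G \<otimes> G'"
  by (simp add: F'.G_def expand_simps G_central G_central(1)[THEN left_commute_eq])

text \<open>\<open>G\<close> and \<open>G'\<close> act as opaque central symbols moved to the left,
  and products of \<open>p\<close> and \<open>m\<close> are eliminated in their favour.\<close>

lemmas pair_simps = expand_simps F.E_0 F'.E_0 F.E_E F'.E_E F.E_E_left F'.E_E_left
  F.E_p F'.E_p F.E_m F'.E_m F.p_m_G F'.p_m_G F.m_p_G F'.m_p_G
  F.E_p[THEN left_commute_smult] F'.E_p[THEN left_commute_smult]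
  F.E_m[THEN left_commute_smult] F'.E_m[THEN left_commute_smult]
  F.p_m_G[THEN left_mult_eq] F'.p_m_G[THEN left_mult_eq] F.m_p_G[THEN left_mult_eq] F'.m_p_G[THEN left_mult_eq]
  commute commute[THEN left_commute_eq] G_central G_central[THEN left_commute_eq]
  G'_G G'_G[THEN left_commute_eq]

definition X where "X = E 1 \<otimes> E' (- 1)"
definition Y where "Y = E (- 1) \<otimes> E' 1"
definition P where "P = p \<otimes> (inverse q \<odot> E (- 2)) \<otimes> m'"
definition M where "M = m \<otimes> (q \<odot> E (- 2)) \<otimes> p'"
text \<open>With L = \<open>E 1 \<otimes> E' 1\<close>, the exponential q^Delta(J0), this is G L +
  G' L^-1; \<beta>' exchanges L and its inverse.\<close>

definition \<beta> where "\<beta> = G \<otimes> (E 1 \<otimes> E' 1) \<oplus> G' \<otimes> (E (- 1) \<otimes> E' (- 1))"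
definition \<beta>' where "\<beta>' = G \<otimes> (E (- 1) \<otimes> E' (- 1)) \<oplus> G' \<otimes> (E 1 \<otimes> E' 1)"
definition \<delta> where "\<delta> = G \<otimes> G' \<oplus> a\<^sup>2 \<odot> (E 2 \<otimes> E' 2 \<oplus> E (- 2) \<otimes> E' (- 2))"
definition N where "N = c \<odot> \<one> \<oplus> 1 \<odot> (\<beta> \<otimes> Y) \<oplus> c \<odot> (Y \<otimes> Y) \<oplus> 1 \<odot> P \<oplus> 1 \<odot> M"

lemmas elem_defs = X_def Y_def P_def M_def \<beta>_def \<beta>'_def \<delta>_def

text \<open>By \<open>p_m_G\<close> and \<open>m_p_G\<close>, each product is up to exponentials and
  a scalar a trinomial in the first factor times one in the second. Of the nine terms, three form
  \<delta> Y^2, two \<beta>' Y, two \<beta> Y^3, and one each Y^4 and the constant.\<close>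

lemma products:
  "P \<otimes> M = q\<^sup>2 \<odot> (\<delta> \<otimes> (Y \<otimes> Y)) \<oplus> (a * q) \<odot> (\<beta>' \<otimes> Y)
       \<oplus> (a * q ^ 3) \<odot> (\<beta> \<otimes> (Y \<otimes> (Y \<otimes> Y))) \<oplus> (a\<^sup>2 * q ^ 4) \<odot> (Y \<otimes> (Y \<otimes> (Y \<otimes> Y))) \<oplus> a\<^sup>2 \<odot> \<one>"
  "M \<otimes> P = inverse (q\<^sup>2) \<odot> (\<delta> \<otimes> (Y \<otimes> Y)) \<oplus> (a / q) \<odot> (\<beta>' \<otimes> Y)
       \<oplus> (a / q ^ 3) \<odot> (\<beta> \<otimes> (Y \<otimes> (Y \<otimes> Y))) \<oplus> (a\<^sup>2 / q ^ 4) \<odot> (Y \<otimes> (Y \<otimes> (Y \<otimes> Y))) \<oplus> a\<^sup>2 \<odot> \<one>"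
proof -
  define ms where "ms = [G \<otimes> (G' \<otimes> (E (- 2) \<otimes> E' 2)), E' 4, E (- 4), G \<otimes> E (- 2), G' \<otimes> E' 2,
    G \<otimes> (E (- 2) \<otimes> E' 4), G' \<otimes> (E (- 4) \<otimes> E' 2), E (- 4) \<otimes> E' 4, \<one>]"
  have ms: "set ms \<subseteq> carrier A" by (simp add: ms_def)
  have basis: "k \<odot> (G \<otimes> (G' \<otimes> (E (- 2) \<otimes> E' 2))) = lincomb [k,0,0,0,0,0,0,0,0] ms"
    "k \<odot> E' 4 = lincomb [0,k,0,0,0,0,0,0,0] ms"
    "k \<odot> E (- 4) = lincomb [0,0,k,0,0,0,0,0,0] ms"
    "k \<odot> (G \<otimes> E (- 2)) = lincomb [0,0,0,k,0,0,0,0,0] ms"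
    "k \<odot> (G' \<otimes> E' 2) = lincomb [0,0,0,0,k,0,0,0,0] ms"
    "k \<odot> (G \<otimes> (E (- 2) \<otimes> E' 4)) = lincomb [0,0,0,0,0,k,0,0,0] ms"
    "k \<odot> (G' \<otimes> (E (- 4) \<otimes> E' 2)) = lincomb [0,0,0,0,0,0,k,0,0] ms"
    "k \<odot> (E (- 4) \<otimes> E' 4) = lincomb [0,0,0,0,0,0,0,k,0] ms"
    "k \<odot> \<one> = lincomb [0,0,0,0,0,0,0,0,k] ms" for k by (simp_all add: ms_def)
  define i where "i = inverse q"
  have i: "inverse (q ^ n) = i ^ n" "y / q ^ n = y * i ^ n" "y / q = y * i" "inverse q = i" for n y
    by (simp_all add: i_def divide_inverse power_inverse)
  note rel = F.scalar_relations(1)[unfolded i]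
  show "P \<otimes> M = q\<^sup>2 \<odot> (\<delta> \<otimes> (Y \<otimes> Y)) \<oplus> (a * q) \<odot> (\<beta>' \<otimes> Y)
       \<oplus> (a * q ^ 3) \<odot> (\<beta> \<otimes> (Y \<otimes> (Y \<otimes> Y))) \<oplus> (a\<^sup>2 * q ^ 4) \<odot> (Y \<otimes> (Y \<otimes> (Y \<otimes> Y))) \<oplus> a\<^sup>2 \<odot> \<one>"
    apply (simp add: elem_defs pair_simps i del: smult_one)
    apply (simp add: basis lincomb_add lincomb_smult ms del: smult_one)
    apply (rule lincomb_cong)
    apply (simp, intro conjI)
    using rel by ((simp add: algebra_simps; fail) | Groebner_Basis.algebra)+
  show "M \<otimes> P = inverse (q\<^sup>2) \<odot> (\<delta> \<otimes> (Y \<otimes> Y)) \<oplus> (a / q) \<odot> (\<beta>' \<otimes> Y)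
       \<oplus> (a / q ^ 3) \<odot> (\<beta> \<otimes> (Y \<otimes> (Y \<otimes> Y))) \<oplus> (a\<^sup>2 / q ^ 4) \<odot> (Y \<otimes> (Y \<otimes> (Y \<otimes> Y))) \<oplus> a\<^sup>2 \<odot> \<one>"
    apply (simp add: elem_defs pair_simps i del: smult_one)
    apply (simp add: basis lincomb_add lincomb_smult ms del: smult_one)
    apply (rule lincomb_cong)
    apply (simp, intro conjI)
    using rel by ((simp add: algebra_simps; fail) | Groebner_Basis.algebra)+
qed

sublocale AW: askey_wilson_data A q a c X Y P M \<beta> \<beta>' \<delta> N
proof
  have cancel: "inverse q * (q * z) = z" "q * (inverse q * z) = z" for z
    by (simp_all add: mult.assoc[symmetric])
  show "P \<otimes> X = inverse (q\<^sup>2) \<odot> (X \<otimes> P)"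
    by (simp add: elem_defs pair_simps power2_eq_square mult.assoc cancel)
  show "P \<otimes> Y = q\<^sup>2 \<odot> (Y \<otimes> P)"
    by (simp add: elem_defs pair_simps power2_eq_square mult.assoc cancel)
  show "M \<otimes> X = q\<^sup>2 \<odot> (X \<otimes> M)"
    by (simp add: elem_defs pair_simps power2_eq_square mult.assoc cancel)
  show "M \<otimes> Y = inverse (q\<^sup>2) \<odot> (Y \<otimes> M)"
    by (simp add: elem_defs pair_simps power2_eq_square mult.assoc cancel)
  show "X \<otimes> \<beta> = \<beta> \<otimes> X" "Y \<otimes> \<beta> = \<beta> \<otimes> Y" "P \<otimes> \<beta> = \<beta> \<otimes> P" "M \<otimes> \<beta> = \<beta> \<otimes> M"
      "X \<otimes> \<beta>' = \<beta>' \<otimes> X" "X \<otimes> \<delta> = \<delta> \<otimes> X"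
    by (simp_all add: elem_defs pair_simps)
qed (simp_all add: F.a_def F.c_def F.q2 products N_def, simp_all add: elem_defs pair_simps)

abbreviation "C1 \<equiv> uq_casimir h A f"
abbreviation "C2 \<equiv> uq_casimir h A g"

lemma C1_eq: "C1 = G \<oplus> c \<odot> \<one>" and C2_eq: "C2 = G' \<oplus> c \<odot> \<one>"
  by (simp_all add: F.casimir_eq F'.casimir_eq)

lemma casimir_commutes:
  "C1 \<otimes> X = X \<otimes> C1" "C2 \<otimes> X = X \<otimes> C2" "C1 \<otimes> N = N \<otimes> C1" "C2 \<otimes> N = N \<otimes> C2"
proof -
  have "G \<otimes> X = X \<otimes> G" "G' \<otimes> X = X \<otimes> G'" "G \<otimes> N = N \<otimes> G" "G' \<otimes> N = N \<otimes> G'"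
    by (simp_all add: N_def elem_defs pair_simps)
  then show "C1 \<otimes> X = X \<otimes> C1" "C2 \<otimes> X = X \<otimes> C2" "C1 \<otimes> N = N \<otimes> C1" "C2 \<otimes> N = N \<otimes> C2"
    by (simp_all add: C1_eq C2_eq expand_simps)
qed

text \<open>\<open>P\<close> and \<open>M\<close> raise the weight in one factor and lower it in the
  other, so the shifts cancel in the sum; exponentials have weight zero.\<close>

lemma J0_commutes:
  "(f Gen_zero \<oplus> g Gen_zero) \<otimes> X = X \<otimes> (f Gen_zero \<oplus> g Gen_zero)"
  "(f Gen_zero \<oplus> g Gen_zero) \<otimes> N = N \<otimes> (f Gen_zero \<oplus> g Gen_zero)"
proof -
  note x_simps = pair_simps F.x_p F'.x_p F.x_m F'.x_m F.x_E F'.x_E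
    F.x_p[THEN left_mult_eq] F'.x_p[THEN left_mult_eq] F.x_m[THEN left_mult_eq] F'.x_m[THEN left_mult_eq]
    F.x_E[THEN left_commute_eq] F'.x_E[THEN left_commute_eq]
  show "(f Gen_zero \<oplus> g Gen_zero) \<otimes> X = X \<otimes> (f Gen_zero \<oplus> g Gen_zero)"
    by (simp add: X_def x_simps)
  have P: "(f Gen_zero \<oplus> g Gen_zero) \<otimes> P = P \<otimes> (f Gen_zero \<oplus> g Gen_zero)"
  proof -
    define ms where "ms = [p \<otimes> (E (- 2) \<otimes> (f Gen_zero \<otimes> m')), p \<otimes> (E (- 2) \<otimes> (m' \<otimes> g Gen_zero)), p \<otimes> (E (- 2) \<otimes> m')]"
    have ms: "set ms \<subseteq> carrier A" by (simp add: ms_def)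
    have basis: "k \<odot> (p \<otimes> (E (- 2) \<otimes> (f Gen_zero \<otimes> m'))) = lincomb [k,0,0] ms"
      "k \<odot> (p \<otimes> (E (- 2) \<otimes> (m' \<otimes> g Gen_zero))) = lincomb [0,k,0] ms"
      "k \<odot> (p \<otimes> (E (- 2) \<otimes> m')) = lincomb [0,0,k] ms" for k by (simp_all add: ms_def)
    show ?thesis
      by (simp add: P_def x_simps del: smult_one)
        (simp add: basis lincomb_add lincomb_smult ms del: smult_one)
  qed
  have M: "(f Gen_zero \<oplus> g Gen_zero) \<otimes> M = M \<otimes> (f Gen_zero \<oplus> g Gen_zero)"
  proof -
    define ms where "ms = [m \<otimes> (E (- 2) \<otimes> (f Gen_zero \<otimes> p')), m \<otimes> (E (- 2) \<otimes> (p' \<otimes> g Gen_zero)), m \<otimes> (E (- 2) \<otimes> p')]"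
    have ms: "set ms \<subseteq> carrier A" by (simp add: ms_def)
    have basis: "k \<odot> (m \<otimes> (E (- 2) \<otimes> (f Gen_zero \<otimes> p'))) = lincomb [k,0,0] ms"
      "k \<odot> (m \<otimes> (E (- 2) \<otimes> (p' \<otimes> g Gen_zero))) = lincomb [0,k,0] ms"
      "k \<odot> (m \<otimes> (E (- 2) \<otimes> p')) = lincomb [0,0,k] ms" for k by (simp_all add: ms_def)
    show ?thesis
      by (simp add: M_def x_simps del: smult_one)
        (simp add: basis lincomb_add lincomb_smult ms del: smult_one)
  qed
  have D: "(f Gen_zero \<oplus> g Gen_zero) \<otimes> (\<beta> \<otimes> Y) = \<beta> \<otimes> Y \<otimes> (f Gen_zero \<oplus> g Gen_zero)"
    "(f Gen_zero \<oplus> g Gen_zero) \<otimes> (Y \<otimes> Y) = Y \<otimes> Y \<otimes> (f Gen_zero \<oplus> g Gen_zero)"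
    by (simp_all add: \<beta>_def Y_def x_simps a_ac)
  have N: "z \<otimes> N = N \<otimes> z"
    if "z \<in> carrier A" "z \<otimes> P = P \<otimes> z" "z \<otimes> M = M \<otimes> z" "z \<otimes> (\<beta> \<otimes> Y) = \<beta> \<otimes> Y \<otimes> z"
      "z \<otimes> (Y \<otimes> Y) = Y \<otimes> Y \<otimes> z" for z
    using that by (simp add: N_def r_distr l_distr smult_mult_l smult_mult_r)
  show "(f Gen_zero \<oplus> g Gen_zero) \<otimes> N = N \<otimes> (f Gen_zero \<oplus> g Gen_zero)"
    by (rule N[OF _ P M D]) simp
qed

text \<open>Since \<beta> Y = G E' 2 + G' E (- 2), passing to \<open>C1\<close> and
  \<open>C2\<close> adds c E' 2 and c E (- 2), which the last bracket removes.\<close>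

lemma N_tensor_form:
  "N = C1 \<otimes> E' 2 \<oplus> E (- 2) \<otimes> C2 \<oplus> P \<oplus> M
     \<oplus> c \<odot> (E (- 2) \<otimes> E' 2 \<ominus> E' 2 \<ominus> E (- 2) \<oplus> \<one>)"
proof -
  define ms where "ms = [G \<otimes> E' 2, G' \<otimes> E (- 2), E (- 2) \<otimes> E' 2, E' 2, E (- 2), \<one>, P, M]"
  have ms: "set ms \<subseteq> carrier A" by (simp add: ms_def)
  have basis: "k \<odot> (G \<otimes> E' 2) = lincomb [k,0,0,0,0,0,0,0] ms"
    "k \<odot> (G' \<otimes> E (- 2)) = lincomb [0,k,0,0,0,0,0,0] ms"
    "k \<odot> (E (- 2) \<otimes> E' 2) = lincomb [0,0,k,0,0,0,0,0] ms"
    "k \<odot> E' 2 = lincomb [0,0,0,k,0,0,0,0] ms"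
    "k \<odot> E (- 2) = lincomb [0,0,0,0,k,0,0,0] ms"
    "k \<odot> \<one> = lincomb [0,0,0,0,0,k,0,0] ms"
    "k \<odot> P = lincomb [0,0,0,0,0,0,k,0] ms"
    "k \<odot> M = lincomb [0,0,0,0,0,0,0,k] ms" for k by (simp_all add: ms_def)
  have "N = (1 \<odot> G \<oplus> c \<odot> \<one>) \<otimes> E' 2 \<oplus> E (- 2) \<otimes> (1 \<odot> G' \<oplus> c \<odot> \<one>) \<oplus> 1 \<odot> P \<oplus> 1 \<odot> M
     \<oplus> c \<odot> (E (- 2) \<otimes> E' 2 \<ominus> E' 2 \<ominus> E (- 2) \<oplus> \<one>)"
    by (simp add: N_def \<beta>_def Y_def pair_simps del: smult_one)
      (simp add: basis lincomb_add lincomb_smult ms del: smult_one)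
  then show ?thesis by (simp add: C1_eq C2_eq)
qed

text \<open>P X and q^-2 M X both carry the scalar q^-1, and (1 + q) q^-1 = 1 + q^-1.\<close>

lemma commutator_tensor_form:
  "(1 / 8 * (1 + q)) \<odot> (P \<otimes> X \<ominus> inverse (q\<^sup>2) \<odot> (M \<otimes> X)) =
   (1 / 8 * (1 + inverse q)) \<odot> ((p \<otimes> m' \<ominus> m \<otimes> p') \<otimes> (E (- 1) \<otimes> E' (- 1)))"
proof -
  define i where "i = inverse q"
  have i: "inverse (q ^ n) = i ^ n" "inverse q = i" for n
    by (simp_all add: i_def power_inverse)
  have rel: "q * i = 1" by (simp add: i_def)
  show ?thesis
    apply (simp add: P_def M_def X_def pair_simps i del: smult_one)
    apply (rule arg_cong2[where f = "(\<oplus>)"]; rule arg_cong2[where f = "(\<odot>)"]; (rule refl)?)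
    using rel by Groebner_Basis.algebra+
qed

text \<open>With L = q^Delta(J0), the squared bracket is (L - 2 + L^-1)/(q - q^-1)^2, and (1 +
  q^-2)/(q - q^-1)^2 = c. The multiples of L and L^-1 cancel the constants in \<open>C1\<close> and
  \<open>C2\<close>, leaving 2 c.\<close>

lemma \<xi>\<^sub>7_tensor_form:
  "AW.\<xi>\<^sub>7 = ((1 + q)\<^sup>2 / (32 * q\<^sup>2)) \<odot> (C1 \<otimes> (E 1 \<otimes> E' 1) \<oplus> C2 \<otimes> (E (- 1) \<otimes> E' (- 1))
     \<ominus> (1 + inverse (q\<^sup>2)) \<odot> (q_bracket A q (\<lambda>l. E l \<otimes> E' l) (1 / 2) [^] (2::nat)))"
proof -
  define v where "v = 1 / (q - inverse q)"
  define ms where "ms = [G \<otimes> (E 1 \<otimes> E' 1), G' \<otimes> (E (- 1) \<otimes> E' (- 1)), E 1 \<otimes> E' 1, E (- 1) \<otimes> E' (- 1), \<one>]"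
  have ms: "set ms \<subseteq> carrier A" by (simp add: ms_def)
  have basis: "k \<odot> (G \<otimes> (E 1 \<otimes> E' 1)) = lincomb [k,0,0,0,0] ms"
    "k \<odot> (G' \<otimes> (E (- 1) \<otimes> E' (- 1))) = lincomb [0,k,0,0,0] ms"
    "k \<odot> (E 1 \<otimes> E' 1) = lincomb [0,0,k,0,0] ms"
    "k \<odot> (E (- 1) \<otimes> E' (- 1)) = lincomb [0,0,0,k,0] ms"
    "k \<odot> \<one> = lincomb [0,0,0,0,k] ms" for k by (simp_all add: ms_def)
  define i where "i = inverse q"
  have "v * (q - i) = 1" using AW.q_nz by (simp add: v_def i_def field_simps power2_eq_square)
  note rel = this F.scalar_relations(1-3)[folded i_def]
  have i: "inverse (q ^ n) = i ^ n" "x / (k * q ^ n) = x * i ^ n / k" "inverse q = i" for n x k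
    by (simp_all add: i_def divide_inverse power_inverse)
  have cl: "q_bracket A q (\<lambda>l. E l \<otimes> E' l) (1 / 2) \<in> carrier A" by (simp add: q_bracket_def)
  show ?thesis
    unfolding square_eq[OF cl] AW.\<xi>\<^sub>7_def
    unfolding q_bracket_def v_def[symmetric]
    apply (simp add: C1_eq C2_eq \<beta>_def pair_simps i del: smult_one)
    apply (simp add: basis lincomb_add lincomb_smult ms del: smult_one)
    apply (rule lincomb_cong)
    apply (simp, intro conjI)
    using rel by ((simp add: algebra_simps; fail) | Groebner_Basis.algebra)+
qed

text \<open>The constants cancel in \<open>C1 \<ominus> C2\<close>, and (G - G')(L - L^-1) = \<beta>
  - \<beta>' for L = q^Delta(J0).\<close>

lemma \<xi>\<^sub>5_tensor_form:
  "(1 / (q - inverse q)) \<odot> (\<beta> \<ominus> \<beta>') = (C1 \<ominus> C2) \<otimes> q_bracket A q (\<lambda>l. E l \<otimes> E' l) 1"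
proof -
  define v where "v = 1 / (q - inverse q)"
  define ms where "ms = [G \<otimes> (E 1 \<otimes> E' 1), G \<otimes> (E (- 1) \<otimes> E' (- 1)),
    G' \<otimes> (E 1 \<otimes> E' 1), G' \<otimes> (E (- 1) \<otimes> E' (- 1)), E 1 \<otimes> E' 1, E (- 1) \<otimes> E' (- 1)]"
  have ms: "set ms \<subseteq> carrier A" by (simp add: ms_def)
  have basis: "k \<odot> (G \<otimes> (E 1 \<otimes> E' 1)) = lincomb [k,0,0,0,0,0] ms"
    "k \<odot> (G \<otimes> (E (- 1) \<otimes> E' (- 1))) = lincomb [0,k,0,0,0,0] ms"
    "k \<odot> (G' \<otimes> (E 1 \<otimes> E' 1)) = lincomb [0,0,k,0,0,0] ms"
    "k \<odot> (G' \<otimes> (E (- 1) \<otimes> E' (- 1))) = lincomb [0,0,0,k,0,0] ms"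
    "k \<odot> (E 1 \<otimes> E' 1) = lincomb [0,0,0,0,k,0] ms"
    "k \<odot> (E (- 1) \<otimes> E' (- 1)) = lincomb [0,0,0,0,0,k] ms" for k by (simp_all add: ms_def)
  show ?thesis
    by (simp add: C1_eq C2_eq \<beta>_def \<beta>'_def q_bracket_def v_def[symmetric] pair_simps del: smult_one)
      (simp add: basis lincomb_add lincomb_smult ms del: smult_one)
qed

text \<open>Multiplying out gives mixed terms \<open>P\<close> and \<open>M\<close> and diagonal
  terms with p m and p' m'. By \<open>p_m_G\<close> the latter give \<beta> Y, terms cancelled by
  the tail of the Casimir formula, and a (q + q^-1) Y^2 = c Y^2.\<close>

lemma casimir_coproduct:
  assumes "d Gen_plus = p \<otimes> E' 2 \<oplus> p'" "d Gen_minus = m \<otimes> E' 2 \<oplus> m'"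
    "\<And>l. d (Gen_exp l) = E l \<otimes> E' l"
  shows "uq_casimir h A d = N"
proof -
  define ms where "ms = [G \<otimes> E' 2, G' \<otimes> E (- 2), E (- 2) \<otimes> E' 2, E 2 \<otimes> E' 2, E (- 2) \<otimes> E' (- 2), \<one>,
    p \<otimes> (E (- 2) \<otimes> m'), m \<otimes> (E (- 2) \<otimes> p')]"
  have ms: "set ms \<subseteq> carrier A" by (simp add: ms_def)
  have basis: "k \<odot> (G \<otimes> E' 2) = lincomb [k,0,0,0,0,0,0,0] ms"
    "k \<odot> (G' \<otimes> E (- 2)) = lincomb [0,k,0,0,0,0,0,0] ms"
    "k \<odot> (E (- 2) \<otimes> E' 2) = lincomb [0,0,k,0,0,0,0,0] ms"
    "k \<odot> (E 2 \<otimes> E' 2) = lincomb [0,0,0,k,0,0,0,0] ms"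
    "k \<odot> (E (- 2) \<otimes> E' (- 2)) = lincomb [0,0,0,0,k,0,0,0] ms"
    "k \<odot> \<one> = lincomb [0,0,0,0,0,k,0,0] ms"
    "k \<odot> (p \<otimes> (E (- 2) \<otimes> m')) = lincomb [0,0,0,0,0,0,k,0] ms"
    "k \<odot> (m \<otimes> (E (- 2) \<otimes> p')) = lincomb [0,0,0,0,0,0,0,k] ms" for k by (simp_all add: ms_def)
  define i where "i = inverse q"
  have i: "inverse (q ^ n) = i ^ n" "inverse q = i" for n
    by (simp_all add: i_def power_inverse)
  have rel: "q * i = 1" "q * i\<^sup>2 = i" "c = a * (q + i)"
    using F.scalar_relations(1,3) by (simp_all add: i_def power2_eq_square)
  show ?thesis
    unfolding uq_casimir_def Let_def assms F.log_q F.a_def[symmetric] F.c_def[symmetric]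
    apply (simp add: N_def \<beta>_def Y_def P_def M_def pair_simps i del: smult_one)
    apply (simp add: basis lincomb_add lincomb_smult ms del: smult_one)
    apply (rule lincomb_cong)
    apply (simp, intro conjI)
    using rel by Groebner_Basis.algebra+
qed

end

section \<open>Homomorphisms out of the quantum algebra\<close>

text \<open>Composed with the quotient map, \<phi> becomes a homomorphism of the free algebra that
  kills the relations.\<close>

lemma uq_family_hom:
  assumes \<phi>: "\<phi> \<in> algebra_hom (Uq h) B" and B: "complex_algebra B"
  shows "uq_family h B (\<lambda>s. \<phi> (uq_gen h s))"
proof -
  interpret R: complex_algebra free_algebra by (rule complex_algebra_free)
  interpret B: complex_algebra B by fact
  have S: "uq_rels h \<subseteq> carrier free_algebra" by simp
  note \<pi> = R.quot_class_hom[OF S]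
  define F where "F = (\<lambda>r. \<phi> (quot_class free_algebra (uq_rels h) r))"
  have F: "F \<in> algebra_hom free_algebra B"
    using algebra_homD[OF \<pi>] algebra_homD[OF \<phi>]
    by (auto simp: algebra_hom_def ring_hom_def F_def Uq_def)
  have "F r = \<zero>\<^bsub>B\<^esub>" if "r \<in> uq_rels h" for r
  proof -
    have "quot_class free_algebra (uq_rels h) r = \<zero>\<^bsub>Uq h\<^esub>"
      using that uq_family_iff[OF \<pi> R.complex_algebra_quot[OF S], of h] uq_family_uq_gen[of h]
      by (simp add: Uq_def uq_gen_def[abs_def])
    \<comment> \<open>\<open>algebra_hom\<close> does not postulate that zero goes to zero; this
      follows by writing zero as 0 times itself.\<close>
    then show ?thesis
      using algebra_homD(5)[OF \<phi>, of "\<zero>\<^bsub>Uq h\<^esub>" 0] algebra_homD(1)[OF \<phi>, of "\<zero>\<^bsub>Uq h\<^esub>"]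
        complex_algebra.smult_zero_left[OF complex_algebra_Uq[of h], of "\<zero>\<^bsub>Uq h\<^esub>"]
        ring.ring_simprules(2)[OF complex_algebra.axioms(1)[OF complex_algebra_Uq[of h]]]
      by (simp add: F_def)
  qed
  then show ?thesis
    using uq_family_iff[OF F B, of h] by (simp add: F_def uq_gen_def)
qed

lemma casimir_hom:
  assumes \<phi>: "\<phi> \<in> algebra_hom (Uq h) B" and B: "complex_algebra B"
  shows "\<phi> (casimir h) = uq_casimir h B (\<lambda>s. \<phi> (uq_gen h s))"
proof -
  interpret U: complex_algebra "Uq h" by (rule complex_algebra_Uq)
  note hom = algebra_homD[OF \<phi>] algebra_hom_minus[OF \<phi> complex_algebra_Uq B]
  have "exp (- h) = inverse (exp h)" by (rule exp_minus)
  then show ?thesis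
    by (simp add: casimir_def uq_casimir_def Let_def hom qJ_def Jp_def Jm_def)
qed

text \<open>Provides the two commuting images required by \<open>uq_pair\<close> and turns pure
  tensors into products.\<close>

lemma tens_left_hom: "(\<lambda>x. tens h x \<one>\<^bsub>Uq h\<^esub>) \<in> algebra_hom (Uq h) (Uq2 h)"
  and tens_right_hom: "tens h \<one>\<^bsub>Uq h\<^esub> \<in> algebra_hom (Uq h) (Uq2 h)"
  and tens_split: "x \<in> carrier (Uq h) \<Longrightarrow> y \<in> carrier (Uq h) \<Longrightarrow>
    tens h x y = tens h x \<one>\<^bsub>Uq h\<^esub> \<otimes>\<^bsub>Uq2 h\<^esub> tens h \<one>\<^bsub>Uq h\<^esub> y"
  and tens_commute: "x \<in> carrier (Uq h) \<Longrightarrow> y \<in> carrier (Uq h) \<Longrightarrow>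
    tens h \<one>\<^bsub>Uq h\<^esub> y \<otimes>\<^bsub>Uq2 h\<^esub> tens h x \<one>\<^bsub>Uq h\<^esub> = tens h x \<one>\<^bsub>Uq h\<^esub> \<otimes>\<^bsub>Uq2 h\<^esub> tens h \<one>\<^bsub>Uq h\<^esub> y"
proof -
  interpret U: complex_algebra "Uq h" by (rule complex_algebra_Uq)
  interpret TA: two_algebras "Uq h" "Uq h" ..
  note t = TA.pure_tensor_add_left TA.pure_tensor_add_right TA.pure_tensor_smult_left
    TA.pure_tensor_smult_right TA.pure_tensor_mult TA.pure_tensor_one
  show "(\<lambda>x. tens h x \<one>\<^bsub>Uq h\<^esub>) \<in> algebra_hom (Uq h) (Uq2 h)"
    "tens h \<one>\<^bsub>Uq h\<^esub> \<in> algebra_hom (Uq h) (Uq2 h)"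
    by (auto simp: algebra_hom_def ring_hom_def tens_def Uq2_def t)
  show "x \<in> carrier (Uq h) \<Longrightarrow> y \<in> carrier (Uq h) \<Longrightarrow>
    tens h x y = tens h x \<one>\<^bsub>Uq h\<^esub> \<otimes>\<^bsub>Uq2 h\<^esub> tens h \<one>\<^bsub>Uq h\<^esub> y"
    "x \<in> carrier (Uq h) \<Longrightarrow> y \<in> carrier (Uq h) \<Longrightarrow>
    tens h \<one>\<^bsub>Uq h\<^esub> y \<otimes>\<^bsub>Uq2 h\<^esub> tens h x \<one>\<^bsub>Uq h\<^esub> = tens h x \<one>\<^bsub>Uq h\<^esub> \<otimes>\<^bsub>Uq2 h\<^esub> tens h \<one>\<^bsub>Uq h\<^esub> y"
    by (simp_all add: tens_def Uq2_def t)
qed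

lemma casimir_closed: "casimir h \<in> carrier (Uq h)"
proof -
  interpret U: complex_algebra "Uq h" by (rule complex_algebra_Uq)
  show ?thesis by (simp add: casimir_def Let_def qJ_def Jp_def Jm_def)
qed

section \<open>The relations in the tensor square\<close>

theorem mainTheorem2:
  fixes q h :: complex
    and U :: "(complex, uq_elem) module"
    and T :: "(complex, uq2_elem) module" (structure)
    and J\<^sub>0 J\<^sub>p J\<^sub>m C :: uq_elem
    and tensor :: "uq_elem \<Rightarrow> uq_elem \<Rightarrow> uq2_elem" (infixl \<open>\<otimes>\<^sub>t\<close> 75)
    and \<Delta> :: "uq_elem \<Rightarrow> uq2_elem"
    and qJ12 :: "complex \<Rightarrow> uq2_elem"
    and C1 C2 J12 K1 K2 K3 \<xi>\<^sub>3 \<xi>\<^sub>5 \<xi>\<^sub>7 :: uq2_elem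
    and r \<xi>\<^sub>1 \<xi>\<^sub>2 \<xi>\<^sub>4 \<xi>\<^sub>6 :: complex
  assumes q_norm: "0 < norm q" "norm q < 1"
    and log_q: "exp h = q"
    and "U = Uq h" and "T = Uq2 h" and "tensor = tens h" and "\<Delta> = coproduct h"
    and "J\<^sub>0 = J0 h" and "J\<^sub>p = Jp h" and "J\<^sub>m = Jm h" and "C = casimir h"
    and "C1 = C \<otimes>\<^sub>t \<one>\<^bsub>U\<^esub>" and "C2 = \<one>\<^bsub>U\<^esub> \<otimes>\<^sub>t C" and "J12 = \<Delta> J\<^sub>0"
    and "qJ12 = (\<lambda>l. qJ h l 0 \<otimes>\<^sub>t qJ h l 0)"
    and "K1 = (1 / 4) \<odot> ((1 / (1 - q)) \<odot> (\<one> \<ominus> qJ h 1 0 \<otimes>\<^sub>t qJ h (-1) 0))"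
    and "K2 = (1 / 2) \<odot> \<Delta> C"
    and "K3 = commutator T K1 K2"
    and "r = - (q - inverse q)\<^sup>2"
    and "\<xi>\<^sub>1 = (1 + inverse (q\<^sup>2)) / 2"
    and "\<xi>\<^sub>2 = (1 + q)\<^sup>2 * (1 - q) / (4 * q\<^sup>2)"
    and "\<xi>\<^sub>3 = (4 * (q - 1)) \<odot> \<xi>\<^sub>7"
    and "\<xi>\<^sub>4 = 0"
    and "\<xi>\<^sub>5 = (- ((1 + q) * (1 + q\<^sup>2) / (16 * q ^ 3))) \<odot> ((C1 \<ominus> C2) \<otimes> q_bracket T q qJ12 1)"
    and "\<xi>\<^sub>6 = - ((1 + q)\<^sup>2 / (16 * q\<^sup>2))"
    and "\<xi>\<^sub>7 = ((1 + q)\<^sup>2 / (32 * q\<^sup>2)) \<odot>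
           (C1 \<otimes> qJ12 1 \<oplus> C2 \<otimes> qJ12 (-1)
             \<ominus> (1 + inverse (q\<^sup>2)) \<odot> (q_bracket T q qJ12 (1 / 2) [^] (2::nat)))"
  shows
    "K2 = (1 / 2) \<odot>
       (C \<otimes>\<^sub>t qJ h 2 0 \<oplus> qJ h (-2) 0 \<otimes>\<^sub>t C
         \<oplus> (J\<^sub>p \<otimes>\<^bsub>U\<^esub> qJ h (-2) (-1)) \<otimes>\<^sub>t J\<^sub>m \<oplus> (J\<^sub>m \<otimes>\<^bsub>U\<^esub> qJ h (-2) 1) \<otimes>\<^sub>t J\<^sub>p
         \<oplus> ((q\<^sup>2 + 1) / (q\<^sup>2 - 1)\<^sup>2) \<odot>
             (qJ h (-2) 0 \<otimes>\<^sub>t qJ h 2 0 \<ominus> \<one>\<^bsub>U\<^esub> \<otimes>\<^sub>t qJ h 2 0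
               \<ominus> qJ h (-2) 0 \<otimes>\<^sub>t \<one>\<^bsub>U\<^esub> \<oplus> \<one>\<^bsub>U\<^esub> \<otimes>\<^sub>t \<one>\<^bsub>U\<^esub>))
     \<and> K3 = (1 / 8 * (1 + inverse q)) \<odot>
         ((J\<^sub>p \<otimes>\<^sub>t J\<^sub>m \<ominus> J\<^sub>m \<otimes>\<^sub>t J\<^sub>p) \<otimes> (qJ h (-1) 0 \<otimes>\<^sub>t qJ h (-1) 0))
     \<and> (\<forall>X\<in>{C1, C2, J12}. \<forall>K\<in>{K1, K2, K3}. X \<otimes> K = K \<otimes> X)
     \<and> commutator T K1 K2 = K3
     \<and> commutator T K2 K3 =
         r \<odot> (K2 \<otimes> K1 \<otimes> K2) \<oplus> \<xi>\<^sub>1 \<odot> anticommutator T K1 K2 \<oplus> \<xi>\<^sub>2 \<odot> (K2 [^] (2::nat))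
           \<oplus> \<xi>\<^sub>3 \<otimes> K2 \<oplus> \<xi>\<^sub>4 \<odot> K1 \<oplus> \<xi>\<^sub>5
     \<and> commutator T K3 K1 =
         r \<odot> (K1 \<otimes> K2 \<otimes> K1) \<oplus> \<xi>\<^sub>1 \<odot> (K1 [^] (2::nat)) \<oplus> \<xi>\<^sub>2 \<odot> anticommutator T K1 K2
           \<oplus> \<xi>\<^sub>3 \<otimes> K1 \<oplus> \<xi>\<^sub>6 \<odot> K2 \<oplus> \<xi>\<^sub>7"
proof -
  note eqs = assms(4-) 
  \<comment> \<open>Both square roots of 1 have norm one; excluding them makes 1 - q and q - q^-1
    invertible.\<close>
  have q2: "q\<^sup>2 \<noteq> 1"
  proof
    assume "q\<^sup>2 = 1"
    then have "norm q ^ 2 = 1" by (metis norm_power norm_one)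
    then show False using q_norm by (simp add: power2_eq_1_iff)
  qed
  interpret U: complex_algebra "Uq h" by (rule complex_algebra_Uq)
  interpret T: complex_algebra "Uq2 h" by (rule complex_algebra_Uq2)
  define f where "f = (\<lambda>s. tens h (uq_gen h s) \<one>\<^bsub>Uq h\<^esub>)"
  define g where "g = (\<lambda>s. tens h \<one>\<^bsub>Uq h\<^esub> (uq_gen h s))"
  interpret W: uq_pair "Uq2 h" h q f g
  proof
    show "uq_family h (Uq2 h) f" unfolding f_def by (rule uq_family_hom[OF tens_left_hom complex_algebra_Uq2])
    show "uq_family h (Uq2 h) g" unfolding g_def by (rule uq_family_hom[OF tens_right_hom complex_algebra_Uq2])
    show "g t \<otimes>\<^bsub>Uq2 h\<^esub> f s = f s \<otimes>\<^bsub>Uq2 h\<^esub> g t" for s t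
      by (simp add: f_def g_def tens_commute)
  qed (use log_q q2 in auto)
  note left = algebra_homD[OF tens_left_hom[of h]] and right = algebra_homD[OF tens_right_hom[of h]]
  have one: "tens h \<one>\<^bsub>Uq h\<^esub> \<one>\<^bsub>Uq h\<^esub> = \<one>\<^bsub>Uq2 h\<^esub>" by (rule right)
  have C1: "C1 = W.C1" and C2: "C2 = W.C2"
    using casimir_hom[OF tens_left_hom complex_algebra_Uq2] casimir_hom[OF tens_right_hom complex_algebra_Uq2]
    by (simp_all add: eqs f_def g_def)
  have J12: "J12 = f Gen_zero \<oplus>\<^bsub>Uq2 h\<^esub> g Gen_zero"
    by (simp add: eqs J0_def coproduct_uq_gen f_def g_def)
  have qJ12: "qJ12 = (\<lambda>l. f (Gen_exp l) \<otimes>\<^bsub>Uq2 h\<^esub> g (Gen_exp l))"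
    by (simp add: eqs f_def g_def tens_split[of "uq_gen h (Gen_exp _)" h "uq_gen h (Gen_exp _)"])
  have "\<Delta> C = W.N"
  proof -
    have "\<Delta> C = uq_casimir h (Uq2 h) (coproduct_gen h)"
      \<comment> \<open>As the coproduct is a homomorphism, Delta(C) is the Casimir formula at the
        coproducts of the generators.\<close>
      using casimir_hom[OF coproduct_hom complex_algebra_Uq2] by (simp add: eqs coproduct_uq_gen)
    also have "\<dots> = W.N"
      by (rule W.casimir_coproduct)
        (simp_all add: f_def g_def Jp_def Jm_def tens_split[of "uq_gen h _" h "uq_gen h _"])
    finally show ?thesis .
  qed
  then have K2: "K2 = W.AW.K2" by (simp add: W.AW.K2_def eqs)
  have tfg: "uq_gen h s \<otimes>\<^sub>t uq_gen h t = f s \<otimes>\<^bsub>Uq2 h\<^esub> g t" for s t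
    by (simp add: eqs f_def g_def tens_split[of "uq_gen h s" h "uq_gen h t"])
  have K1: "K1 = W.AW.K1"
    unfolding W.AW.K1_def unfolding W.X_def tfg[symmetric] by (simp add: eqs)
  have K3: "K3 = commutator (Uq2 h) W.AW.K1 W.AW.K2"
    unfolding \<open>K3 = commutator T K1 K2\<close> K1 K2 \<open>T = Uq2 h\<close> ..
  have \<xi>\<^sub>7: "\<xi>\<^sub>7 = W.AW.\<xi>\<^sub>7"
    unfolding W.\<xi>\<^sub>7_tensor_form assms(26) C1 C2 qJ12 \<open>T = Uq2 h\<close> ..
  have \<xi>\<^sub>5: "\<xi>\<^sub>5 = (- ((1 + q) * (1 + q\<^sup>2) / (16 * q ^ 3 * (q - inverse q)))) \<odot>\<^bsub>Uq2 h\<^esub> (W.\<beta> \<ominus>\<^bsub>Uq2 h\<^esub> W.\<beta>')"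
    unfolding assms(24) C1 C2 qJ12 \<open>T = Uq2 h\<close> W.\<xi>\<^sub>5_tensor_form[symmetric]
    by (simp flip: T.smult_assoc)
  have K2_form: "K2 = (1 / 2) \<odot>
       (C \<otimes>\<^sub>t qJ h 2 0 \<oplus> qJ h (-2) 0 \<otimes>\<^sub>t C
         \<oplus> (J\<^sub>p \<otimes>\<^bsub>U\<^esub> qJ h (-2) (-1)) \<otimes>\<^sub>t J\<^sub>m \<oplus> (J\<^sub>m \<otimes>\<^bsub>U\<^esub> qJ h (-2) 1) \<otimes>\<^sub>t J\<^sub>p
         \<oplus> ((q\<^sup>2 + 1) / (q\<^sup>2 - 1)\<^sup>2) \<odot>
             (qJ h (-2) 0 \<otimes>\<^sub>t qJ h 2 0 \<ominus> \<one>\<^bsub>U\<^esub> \<otimes>\<^sub>t qJ h 2 0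
               \<ominus> qJ h (-2) 0 \<otimes>\<^sub>t \<one>\<^bsub>U\<^esub> \<oplus> \<one>\<^bsub>U\<^esub> \<otimes>\<^sub>t \<one>\<^bsub>U\<^esub>))"
  proof -
    have "C \<otimes>\<^sub>t qJ h 2 0 = W.C1 \<otimes>\<^bsub>Uq2 h\<^esub> g (Gen_exp 2)" "qJ h (-2) 0 \<otimes>\<^sub>t C = f (Gen_exp (-2)) \<otimes>\<^bsub>Uq2 h\<^esub> W.C2"
      unfolding C1[symmetric] C2[symmetric]
      by (simp_all add: eqs f_def g_def casimir_closed tens_split[of "casimir h" h "uq_gen h _"] tens_split[of "uq_gen h _" h "casimir h"])
    moreover have "(J\<^sub>p \<otimes>\<^bsub>U\<^esub> qJ h (-2) (-1)) \<otimes>\<^sub>t J\<^sub>m = W.P" "(J\<^sub>m \<otimes>\<^bsub>U\<^esub> qJ h (-2) 1) \<otimes>\<^sub>t J\<^sub>p = W.M"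
      unfolding W.P_def W.M_def unfolding log_q[symmetric]
      by (simp_all add: eqs f_def g_def left Jp_def Jm_def qJ_def exp_minus tens_split[of "_ \<otimes>\<^bsub>Uq h\<^esub> _" h "uq_gen h _"])
    moreover have "\<one>\<^bsub>U\<^esub> \<otimes>\<^sub>t qJ h 2 0 = g (Gen_exp 2)" "qJ h (-2) 0 \<otimes>\<^sub>t \<one>\<^bsub>U\<^esub> = f (Gen_exp (-2))"
      "\<one>\<^bsub>U\<^esub> \<otimes>\<^sub>t \<one>\<^bsub>U\<^esub> = \<one>\<^bsub>Uq2 h\<^esub>" "qJ h (-2) 0 \<otimes>\<^sub>t qJ h 2 0 = f (Gen_exp (-2)) \<otimes>\<^bsub>Uq2 h\<^esub> g (Gen_exp 2)"
      unfolding qJ_zero tfg by (simp_all add: eqs f_def g_def one)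
    ultimately show ?thesis
      unfolding K2 W.AW.K2_def unfolding W.N_tensor_form by (simp only: \<open>T = Uq2 h\<close> W.F.c_def)
  qed
  have K3_form: "K3 = (1 / 8 * (1 + inverse q)) \<odot>
         ((J\<^sub>p \<otimes>\<^sub>t J\<^sub>m \<ominus> J\<^sub>m \<otimes>\<^sub>t J\<^sub>p) \<otimes> (qJ h (-1) 0 \<otimes>\<^sub>t qJ h (-1) 0))"
  proof -
    have J: "J\<^sub>p = uq_gen h Gen_plus" "J\<^sub>m = uq_gen h Gen_minus" by (simp_all add: eqs Jp_def Jm_def)
    show ?thesis
      unfolding K3 W.AW.commutator_K1_K2 W.commutator_tensor_form J qJ_zero tfg \<open>T = Uq2 h\<close> ..
  qed
  have "\<forall>X\<in>{C1, C2, J12}. \<forall>K\<in>{K1, K2, K3}. X \<otimes> K = K \<otimes> X"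
    unfolding K3 \<open>T = Uq2 h\<close> unfolding C1 C2 J12 K1 K2
    using W.AW.commutes_K[OF _ W.casimir_commutes(1) W.casimir_commutes(3)]
      W.AW.commutes_K[OF _ W.casimir_commutes(2) W.casimir_commutes(4)]
      W.AW.commutes_K[OF _ W.J0_commutes]
    by (simp add: W.C1_eq W.C2_eq)
  moreover have "commutator T K2 K3 =
         r \<odot> (K2 \<otimes> K1 \<otimes> K2) \<oplus> \<xi>\<^sub>1 \<odot> anticommutator T K1 K2 \<oplus> \<xi>\<^sub>2 \<odot> (K2 [^] (2::nat))
           \<oplus> \<xi>\<^sub>3 \<otimes> K2 \<oplus> \<xi>\<^sub>4 \<odot> K1 \<oplus> \<xi>\<^sub>5"
    using W.AW.askey_wilson_K2_K3
    unfolding K3 \<xi>\<^sub>5 assms(19-23) \<xi>\<^sub>7 \<open>T = Uq2 h\<close> unfolding K1 K2 .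
  moreover have "commutator T K3 K1 =
         r \<odot> (K1 \<otimes> K2 \<otimes> K1) \<oplus> \<xi>\<^sub>1 \<odot> (K1 [^] (2::nat)) \<oplus> \<xi>\<^sub>2 \<odot> anticommutator T K1 K2
           \<oplus> \<xi>\<^sub>3 \<otimes> K1 \<oplus> \<xi>\<^sub>6 \<odot> K2 \<oplus> \<xi>\<^sub>7"
    using W.AW.askey_wilson_K3_K1
    unfolding K3 assms(19-22,25) \<xi>\<^sub>7 \<open>T = Uq2 h\<close> unfolding K1 K2 .
  ultimately show ?thesis
    using K2_form K3_form assms(18) by simp
qed

end
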